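(* Let $A\in\mathbb{H}^{m\times n}$, let $M$ and $N$ be positive definite quaternion matrices of order $m$ and $n$, and let $A^{\sharp}A\in\mathbb{H}^{n\times n}$ be Hermitian. Let $b\in\mathbb{H}^{m\times 1}$, let $\tilde x=(\tilde x_1,\dots,\tilde x_n)^{T}$ be the weighted Moore-Penrose solution of the right system $Ax=b$, and put $f=A^{\sharp}b$. (i) If $\mathrm{rank}\,A=r\le m<n$, then for all $i=1,\dots,n$ $$\tilde x_i=\frac{\sum_{\beta\in J_{r,n}\{i\}}\mathrm{cdet}_i\left(\left(A^{\sharp}A\right)_{.i}(f)\right)^{\beta}_{\beta}}{\sum_{\beta\in J_{r,n}}\left|\left(A^{\sharp}A\right)^{\beta}_{\beta}\right|}.$$ (ii) If $\mathrm{rank}\,A=n$, then for all $i=1,\dots,n$ $$\tilde x_i=\frac{\mathrm{cdet}_i\left(\left(A^{\sharp}A\right)_{.i}(f)\right)}{\det(A^{\sharp}A)}.$$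
   Context: $\mathbb{H}$ is the skew field of real quaternions; $A^{*}$ is the conjugate transpose; $B$ is Hermitian if $B^{*}=B$; $P$ is positive definite if it is Hermitian and $x^{*}Px>0$ for all nonzero columns $x$. $A^{\sharp}:=N^{-1}A^{*}M$. The weighted Moore-Penrose inverse $A^{\dagger}_{M,N}$ is the unique $X\in\mathbb{H}^{n\times m}$ with $AXA=A$, $XAX=X$, $(MAX)^{*}=MAX$, $(NXA)^{*}=NXA$. The weighted Moore-Penrose solution of $Ax=b$ is $\tilde x=A^{\dagger}_{M,N}b$. Column determinants of $B=(b_{ij})\in\mathbb{H}^{n\times n}$. For fixed $j$, write each $\tau\in S_n$ as a product of $r=r(\tau)$ disjoint cycles (1-cycles included) $\tau=(j_{k_r+l_r}\ldots j_{k_r+1}\,j_{k_r})\cdots(j_{k_2+l_2}\ldots j_{k_2+1}\,j_{k_2})(j_{k_1+l_1}\ldots j_{k_1+1}\,j_{k_1}\,j)$, the last (rightmost) cycle ending with $j$, every other cycle ending with its smallest element, and $j_{k_2}<j_{k_3}<\dots<j_{k_r}$. Then $$\mathrm{cdet}_j B=\sum_{\tau\in S_n}(-1)^{n-r}\,b_{j_{k_r}j_{k_r+l_r}}\cdots b_{j_{k_r+1}j_{k_r}}\cdots b_{j j_{k_1+l_1}}\cdots b_{j_{k_1+1}j_{k_1}}b_{j_{k_1}j}.$$ (A 1-cycle $(s)$ contributes the factor $b_{ss}$.) For Hermitian $B$ all $\mathrm{cdet}_jB$ coincide and are real; the common value is $\det B$. $B_{.i}(c)$ is $B$ with its $i$-th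 column replaced by the column $c$. $B^{\beta}_{\beta}$ is the principal submatrix with rows and columns indexed by $\beta$; its rows and columns keep their original indices, so that $\mathrm{cdet}_i(B)^{\beta}_{\beta}$ is the column determinant of the submatrix along the column with original index $i\in\beta$. For Hermitian $B$, $|B^{\beta}_{\beta}|=\det(B^{\beta}_{\beta})$. $L_{k,n}$ ($1\le k\le n$) is the set of strictly increasing sequences of $k$ integers from $\{1,\dots,n\}$; $J_{r,n}=L_{r,n}$, $J_{r,n}\{i\}=\{\beta\in L_{r,n}: i\in\beta\}$; $r\ge1$ is understood. *)

theory Defs
  imports "Jordan_Normal_Form.Determinant" "HOL-Combinatorics.Cycles"
begin

section \<open>The skew field of real quaternions\<close>

datatype quat = Quat (qre: real) (qi: real) (qj: real) (qk: real)

instantiation quat :: ab_group_add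
begin
definition "0 = Quat 0 0 0 0"
definition "x + y = Quat (qre x + qre y) (qi x + qi y) (qj x + qj y) (qk x + qk y)"
definition "- x = Quat (- qre x) (- qi x) (- qj x) (- qk x)"
definition "x - y = Quat (qre x - qre y) (qi x - qi y) (qj x - qj y) (qk x - qk y)"
instance
  by standard (simp_all add: zero_quat_def plus_quat_def uminus_quat_def minus_quat_def)
end

instantiation quat :: ring_1
begin
definition "1 = Quat 1 0 0 0"
definition "x * y = Quat
  (qre x * qre y - qi x * qi y - qj x * qj y - qk x * qk y)
  (qre x * qi y + qi x * qre y + qj x * qk y - qk x * qj y)
  (qre x * qj y - qi x * qk y + qj x * qre y + qk x * qi y)
  (qre x * qk y + qi x * qj y - qj x * qi y + qk x * qre y)"
instance
  by standard
    (simp_all add: zero_quat_def plus_quat_def one_quat_def times_quat_def algebra_simps)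
end

instantiation quat :: real_algebra_1
begin
definition "scaleR r x = Quat (r * qre x) (r * qi x) (r * qj x) (r * qk x)" for x :: quat
instance
  by standard
    (simp_all add: scaleR_quat_def plus_quat_def times_quat_def algebra_simps)
end

definition qcnj :: "quat \<Rightarrow> quat" where
  "qcnj x = Quat (qre x) (- qi x) (- qj x) (- qk x)"

definition qnorm2 :: "quat \<Rightarrow> real" where
  "qnorm2 x = (qre x)\<^sup>2 + (qi x)\<^sup>2 + (qj x)\<^sup>2 + (qk x)\<^sup>2"

lemma qnorm2_eq_0_iff: "qnorm2 x = 0 \<longleftrightarrow> x = 0"
  by (cases x) (auto simp: qnorm2_def zero_quat_def add_nonneg_eq_0_iff)

lemma of_real_quat: "of_real r = Quat r 0 0 0"
  by (simp add: of_real_def scaleR_quat_def one_quat_def)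

lemma qcnj_mult_self: "qcnj x * x = of_real (qnorm2 x)"
  by (simp add: qcnj_def times_quat_def of_real_quat qnorm2_def power2_eq_square)

lemma mult_qcnj_self: "x * qcnj x = of_real (qnorm2 x)"
  by (simp add: qcnj_def times_quat_def of_real_quat qnorm2_def power2_eq_square)

instantiation quat :: division_ring
begin
definition "inverse x = inverse (qnorm2 x) *\<^sub>R qcnj x"
definition "x div y = x * inverse y" for x y :: quat
instance
proof
  fix x y :: quat
  show "x div y = x * inverse y"
    by (rule divide_quat_def)
  show "inverse (0 :: quat) = 0"
    by (simp add: inverse_quat_def qnorm2_def zero_quat_def scaleR_quat_def)
  assume "x \<noteq> 0"
  then have "qnorm2 x \<noteq> 0"
    by (simp add: qnorm2_eq_0_iff)
  then show "inverse x * x = 1" "x * inverse x = 1"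
    by (simp_all add: inverse_quat_def qcnj_mult_self mult_qcnj_self flip: of_real_mult)
       (simp_all add: of_real_def)
qed
end


section \<open>Quaternion matrices\<close>

text \<open>Rows and columns are indexed from 0, so \<open>{1,\<dots>,n}\<close> becomes \<open>{0,\<dots>,n-1}\<close>.\<close>

definition conj_transpose :: "quat mat \<Rightarrow> quat mat" where
  "conj_transpose A = map_mat qcnj (transpose_mat A)"

definition hermitian :: "quat mat \<Rightarrow> bool" where
  "hermitian B \<longleftrightarrow> square_mat B \<and> conj_transpose B = B"

text \<open>For quaternions, \<open>q > 0\<close> means that \<open>q\<close> is a positive real.\<close>

definition positive_definite :: "quat mat \<Rightarrow> bool" where
  "positive_definite P \<longleftrightarrow> hermitian P \<and>
     (\<forall>x \<in> carrier_vec (dim_row P). x \<noteq> 0\<^sub>v (dim_row P) \<longrightarrow>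
        (\<exists>r::real. r > 0 \<and> map_vec qcnj x \<bullet> (P *\<^sub>v x) = of_real r))"

definition mat_inv :: "quat mat \<Rightarrow> quat mat" where
  "mat_inv A = (THE B. B \<in> carrier_mat (dim_row A) (dim_row A) \<and>
                       inverts_mat A B \<and> inverts_mat B A)"

text \<open>The rank is the maximal number of columns that are linearly independent in the
  right vector space of columns.\<close>

definition right_independent_cols :: "quat mat \<Rightarrow> nat set \<Rightarrow> bool" where
  "right_independent_cols A S \<longleftrightarrow>
     (\<forall>c. (\<forall>i < dim_row A. (\<Sum>j\<in>S. A $$ (i, j) * c j) = 0) \<longrightarrow> (\<forall>j\<in>S. c j = 0))"

definition qrank :: "quat mat \<Rightarrow> nat" where
  "qrank A = Max {card S | S. S \<subseteq> {..<dim_col A} \<and> right_independent_cols A S}"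

text \<open>\<open>A\<^sup>\<sharp> = N\<^sup>-\<^sup>1 A\<^sup>* M\<close>\<close>

definition sharp :: "quat mat \<Rightarrow> quat mat \<Rightarrow> quat mat \<Rightarrow> quat mat" where
  "sharp M N A = mat_inv N * conj_transpose A * M"

definition is_weighted_mp_inverse ::
    "quat mat \<Rightarrow> quat mat \<Rightarrow> quat mat \<Rightarrow> quat mat \<Rightarrow> bool" where
  "is_weighted_mp_inverse M N A X \<longleftrightarrow>
     X \<in> carrier_mat (dim_col A) (dim_row A) \<and>
     A * X * A = A \<and> X * A * X = X \<and>
     conj_transpose (M * A * X) = M * A * X \<and>
     conj_transpose (N * X * A) = N * X * A"

definition weighted_mp_inverse :: "quat mat \<Rightarrow> quat mat \<Rightarrow> quat mat \<Rightarrow> quat mat" where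
  "weighted_mp_inverse M N A = (THE X. is_weighted_mp_inverse M N A X)"


section \<open>Column determinants\<close>

text \<open>The cycle of \<open>\<tau>\<close> through \<open>s\<close>, written so as to end with \<open>s\<close>, contributes the factors
  \<open>b\<^bsub>s,\<tau>(s)\<^esub> b\<^bsub>\<tau>(s),\<tau>(\<tau>(s))\<^esub> \<dots> b\<^bsub>t,s\<^esub>\<close> with \<open>\<tau>(t) = s\<close>, in this order.
  \<open>support \<tau> s\<close> is the list \<open>[s, \<tau>(s), \<tau>(\<tau>(s)), \<dots>, t]\<close>.\<close>

definition cycle_prod :: "'a::ring_1 mat \<Rightarrow> (nat \<Rightarrow> nat) \<Rightarrow> nat \<Rightarrow> 'a" where
  "cycle_prod B \<tau> s = prod_list (map (\<lambda>a. B $$ (a, \<tau> a)) (support \<tau> s))"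

text \<open>The last elements of the cycles of a permutation \<open>\<tau>\<close> of \<open>\<beta>\<close>, in the order in which the
  cycles are written from left to right: the minima of the cycles avoiding \<open>j\<close>, decreasing,
  and finally \<open>j\<close>.\<close>

definition cycle_ends :: "nat set \<Rightarrow> nat \<Rightarrow> (nat \<Rightarrow> nat) \<Rightarrow> nat list" where
  "cycle_ends \<beta> j \<tau> =
     rev (sorted_list_of_set
       {s \<in> \<beta>. j \<notin> set (support \<tau> s) \<and> s = Min (set (support \<tau> s))}) @ [j]"

text \<open>\<open>cdet \<beta> j B\<close> is the column determinant, along the column with original index \<open>j \<in> \<beta>\<close>, of
  the principal submatrix of \<open>B\<close> with rows and columns in \<open>\<beta>\<close>; for \<open>B\<close> of order \<open>n\<close> itself
  take \<open>\<beta> = {..<n}\<close>.\<close>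

definition cdet :: "nat set \<Rightarrow> nat \<Rightarrow> 'a::ring_1 mat \<Rightarrow> 'a" where
  "cdet \<beta> j B =
     (\<Sum>\<tau> | \<tau> permutes \<beta>.
        (- 1) ^ (card \<beta> - length (cycle_ends \<beta> j \<tau>)) *
        prod_list (map (cycle_prod B \<tau>) (cycle_ends \<beta> j \<tau>)))"

text \<open>The determinant of a Hermitian (sub)matrix: the common real value of its column
  determinants.\<close>

definition hdet :: "nat set \<Rightarrow> quat mat \<Rightarrow> real" where
  "hdet \<beta> B = (THE d. \<forall>j\<in>\<beta>. cdet \<beta> j B = of_real d)"

text \<open>A strictly increasing sequence is identified with its set of entries.\<close>

definition J :: "nat \<Rightarrow> nat \<Rightarrow> nat set set" where
  "J r n = {\<beta>. \<beta> \<subseteq> {..<n} \<and> card \<beta> = r}"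

definition J_at :: "nat \<Rightarrow> nat \<Rightarrow> nat \<Rightarrow> nat set set" where
  "J_at r n i = {\<beta> \<in> J r n. i \<in> \<beta>}"

end

theory Submission
  imports Defs
begin

text \<open>
  Put \<open>S = A\<^sup>\<sharp>\<close> and \<open>H = S A\<close>. Let \<open>d\<^sub>k\<close> be the sum of the principal minors of order \<open>k\<close> of \<open>H\<close>, and
  let \<open>R\<^sub>k\<close> be the matrix with \<open>(R\<^sub>k v)\<^sub>i = \<Sum>\<^sub>\<beta> cdet\<^sub>i (H\<^sub>.\<^sub>i(v))\<^sub>\<beta>\<close>, the sum over the \<open>\<beta> \<ni> i\<close> of size \<open>k\<close>.
  Splitting a permutation into its cycle through \<open>i\<close> and the rest gives the Faddeev-LeVerrier type recursion
  \<open>R\<^sub>k H + R\<^bsub>k+1\<^esub> = d\<^sub>k I\<close>, so that every \<open>R\<^sub>k\<close> is a real polynomial in \<open>H\<close>.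

  Let \<open>s\<close> be the largest index with \<open>d\<^sub>s \<noteq> 0\<close>. Going down from \<open>R\<^bsub>n+1\<^esub> = 0\<close>, and cancelling powers of the
  Hermitian matrix \<open>H\<close>, one finds \<open>R\<^bsub>s+1\<^esub> H = 0\<close>. Hence \<open>Q = R\<^sub>s / d\<^sub>s\<close> satisfies \<open>H Q H = H\<close>, and
  \<open>X = Q S\<close> satisfies the equations of the weighted Moore-Penrose inverse, because \<open>Q\<close> commutes with
  everything that commutes with \<open>H\<close>. Finally \<open>Q H\<close> has real trace \<open>s\<close>, whereas a matrix \<open>F = Y A\<close> with
  \<open>A F = A\<close> has real trace \<open>rank A\<close>; thus \<open>s = rank A\<close>.
\<close>

section \<open>Column determinants as sums over cycles\<close>

text \<open>A cycle through \<open>i\<close> is written as the list of its elements starting at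
  \<open>i\<close>, the form in which \<open>support \<tau> i\<close> returns it. Fixing the head
  makes the encoding unique.\<close>

definition cycles_at :: "'a set \<Rightarrow> 'a \<Rightarrow> 'a list set" where
  "cycles_at \<beta> i = {xs. distinct xs \<and> set xs \<subseteq> \<beta> \<and> xs \<noteq> [] \<and> hd xs = i}"

text \<open>Product along an open path. The entry closing the cycle is left off so that it can be
  exchanged for a different weight.\<close>

fun path_prod :: "'a::monoid_mult mat \<Rightarrow> nat list \<Rightarrow> 'a" where
  "path_prod B (a # b # xs) = B $$ (a, b) * path_prod B (b # xs)"
| "path_prod B xs = 1"

text \<open>The common part of \<open>cycle_ends\<close> for all permutations with a given cycle through \<open>j\<close>. It also equals
  \<open>cycle_ends \<gamma> (Min \<gamma>) \<sigma>\<close>, so that the remaining cycles contribute a column determinant again.\<close>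

definition ends :: "nat set \<Rightarrow> (nat \<Rightarrow> nat) \<Rightarrow> nat list" where
  "ends \<gamma> \<sigma> = rev (sorted_list_of_set {s \<in> \<gamma>. s = Min (set (support \<sigma> s))})"

text \<open>The empty minor must be \<open>1\<close>, since it is the cofactor of a cycle that
  exhausts the index set. Column \<open>Min \<gamma>\<close> is the one whose ordering of cycles
  agrees with that of the remaining cycles in a larger determinant.\<close>

definition pdet :: "nat set \<Rightarrow> 'a::ring_1 mat \<Rightarrow> 'a" where
  "pdet \<gamma> B = (if \<gamma> = {} then 1 else cdet \<gamma> (Min \<gamma>) B)"

section \<open>Splitting a permutation at one of its cycles\<close>

lemma finite_cycles_at: "finite \<beta> \<Longrightarrow> finite (cycles_at \<beta> i)"
  by (rule finite_subset[OF _ finite_subset_distinct[of \<beta>]]) (auto simp: cycles_at_def)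

lemma mem_support_self:
  assumes "permutation \<tau>"
  shows "s \<in> set (support \<tau> s)"
  using least_power_of_permutation(2)[OF assms, of s] by force

lemma set_support_subset:
  assumes "\<tau> permutes \<beta>" "s \<in> \<beta>"
  shows "set (support \<tau> s) \<subseteq> \<beta>"
  using permutes_in_image[OF permutes_funpow[OF assms(1)]] assms(2) by auto

lemma support_in_cycles_at:
  assumes "\<tau> permutes \<beta>" "finite \<beta>" "i \<in> \<beta>"
  shows "support \<tau> i \<in> cycles_at \<beta> i"
proof -
  have p: "permutation \<tau>" using assms permutation_permutes by blast
  have "least_power \<tau> i > 0" using least_power_of_permutation(2)[OF p] .
  then have "hd (support \<tau> i) = i" "support \<tau> i \<noteq> []"
    by (simp_all add: hd_map)
  then show ?thesis
    using cycle_of_permutation[OF p] set_support_subset[OF assms(1,3)]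
    unfolding cycles_at_def by blast
qed

text \<open>On \<open>xs\<close> the composite acts as the cycle alone, because \<sigma> fixes these
  points. Its powers rotate the list, and distinctness makes \<open>length xs\<close> the least
  power returning to the head. On \<gamma> the cycle acts trivially.\<close>

lemma
  assumes xs: "distinct xs" "xs \<noteq> []" and \<sigma>: "\<sigma> permutes \<gamma>" and disj: "set xs \<inter> \<gamma> = {}"
  defines "\<tau> \<equiv> cycle_of_list xs \<circ> \<sigma>"
  shows map_cycle_comp: "map \<tau> xs = rotate1 xs"
    and support_cycle_comp_hd: "support \<tau> (hd xs) = xs"
    and cycle_comp_outside: "s \<in> \<gamma> \<Longrightarrow> \<tau> s = \<sigma> s"
    and support_cycle_comp_outside: "s \<in> \<gamma> \<Longrightarrow> support \<tau> s = support \<sigma> s"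
    and cycle_comp_permutes: "\<tau> permutes (set xs \<union> \<gamma>)"
proof -
  have on: "\<tau> a = cycle_of_list xs a" if "a \<in> set xs" for a
    using that disj permutes_not_in[OF \<sigma>] by (force simp: \<tau>_def)
  show *: "map \<tau> xs = rotate1 xs"
    using cyclic_rotation[OF xs(1), of 1] on by (simp cong: map_cong)
  have pow: "map (\<tau> ^^ k) xs = rotate k xs" for k
  proof (induction k)
    case (Suc k)
    have "map (\<tau> ^^ Suc k) xs = map (\<tau> ^^ k) (map \<tau> xs)"
      by (simp add: funpow_Suc_right del: funpow.simps)
    also have "\<dots> = rotate1 (map (\<tau> ^^ k) xs)" by (simp add: * rotate1_map)
    finally show ?case by (simp only: Suc rotate_Suc)
  qed simp
  have hd: "(\<tau> ^^ k) (hd xs) = xs ! (k mod length xs)" for k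
    using arg_cong[OF pow[of k], of hd] xs(2) by (simp add: hd_map hd_rotate_conv_nth)
  have "least_power \<tau> (hd xs) = length xs"
    unfolding least_power_def
  proof (rule Least_equality)
    show "(\<tau> ^^ length xs) (hd xs) = hd xs \<and> 0 < length xs"
      using hd[of "length xs"] xs(2) by (simp add: hd_conv_nth)
    fix k assume k: "(\<tau> ^^ k) (hd xs) = hd xs \<and> 0 < k"
    show "length xs \<le> k"
    proof (rule ccontr)
      assume "\<not> length xs \<le> k"
      then have "xs ! k = xs ! 0" "k < length xs" "0 < length xs"
        using k hd[of k] xs(2) by (auto simp: hd_conv_nth)
      then show False using k xs(1) by (simp add: nth_eq_iff_index_eq)
    qed
  qed
  then show "support \<tau> (hd xs) = xs"
    by (intro nth_equalityI) (auto simp: hd)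
  show out: "\<tau> s = \<sigma> s" if "s \<in> \<gamma>" for s
    using that disj permutes_in_image[OF \<sigma>, of s]
    by (auto simp: \<tau>_def intro!: id_outside_supp)
  show "support \<tau> s = support \<sigma> s" if "s \<in> \<gamma>"
  proof -
    have mem: "(\<sigma> ^^ k) s \<in> \<gamma>" for k
      using permutes_in_image[OF permutes_funpow[OF \<sigma>]] that by blast
    have "(\<tau> ^^ k) s = (\<sigma> ^^ k) s" for k
      by (induction k) (simp_all add: out mem)
    then show ?thesis by (simp add: least_power_def)
  qed
  show "\<tau> permutes (set xs \<union> \<gamma>)"
    unfolding \<tau>_def
    by (rule permutes_compose)
      (auto intro: permutes_subset[OF \<sigma>] permutes_subset[OF cycle_permutes])
qed

text \<open>A permutation amounts to its cycle through \<open>i\<close> together with its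
  restriction to the complement of that cycle; composing the two recovers it.\<close>

lemma sum_permutes_cycles_at:
  assumes fin: "finite \<beta>" and i: "i \<in> \<beta>"
  shows "(\<Sum>\<tau> | \<tau> permutes \<beta>. g \<tau>) =
    (\<Sum>xs\<in>cycles_at \<beta> i. \<Sum>\<sigma> | \<sigma> permutes (\<beta> - set xs). g (cycle_of_list xs \<circ> \<sigma>))"
proof -
  let ?S = "SIGMA xs:cycles_at \<beta> i. {\<sigma>. \<sigma> permutes (\<beta> - set xs)}"
  let ?res = "\<lambda>\<tau> y. if y \<in> \<beta> - set (support \<tau> i) then \<tau> y else y"
  have "(\<Sum>\<tau> | \<tau> permutes \<beta>. g \<tau>) = (\<Sum>(xs, \<sigma>)\<in>?S. g (cycle_of_list xs \<circ> \<sigma>))"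
  proof (rule sum.reindex_bij_witness[where
        i = "\<lambda>(xs, \<sigma>). cycle_of_list xs \<circ> \<sigma>" and j = "\<lambda>\<tau>. (support \<tau> i, ?res \<tau>)"])
    fix \<tau> assume "\<tau> \<in> {\<tau>. \<tau> permutes \<beta>}"
    then have \<tau>: "\<tau> permutes \<beta>" by simp
    then have p: "permutation \<tau>" using fin permutation_permutes by blast
    have "cycle_of_list (support \<tau> i) (?res \<tau> a) = \<tau> a" for a
    proof -
      consider "a \<in> \<beta> - set (support \<tau> i)" | "a \<in> set (support \<tau> i)" | "a \<notin> \<beta>" "a \<notin> set (support \<tau> i)"
        by blast
      then show ?thesis
      proof cases
        \<comment> \<open>The image of \<open>a\<close> stays in the cycle of \<open>a\<close>,
          which is disjoint from the cycle through \<open>i\<close>, so the latter fixes it.\<close>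
        case 1
        have "\<tau> a \<in> set (support \<tau> a)"
          unfolding support_set[OF p] by (metis (no_types) funpow_0 funpow.simps(2) comp_apply rangeI)
        then have "\<tau> a \<notin> set (support \<tau> i)"
          using disjoint_support'[OF p, of a i] 1 by blast
        then show ?thesis using 1 id_outside_supp[of "\<tau> a" "support \<tau> i"] by simp
      next
        case 2
        then show ?thesis using cycle_restrict[OF p 2] by (simp del: set_map)
      next
        case 3
        then show ?thesis
          using id_outside_supp[OF 3(2)] permutes_not_in[OF \<tau>] by (simp del: set_map)
      qed
    qed
    then have eq: "cycle_of_list (support \<tau> i) \<circ> ?res \<tau> = \<tau>" by (simp add: fun_eq_iff del: set_map)
    show "(case (support \<tau> i, ?res \<tau>) of (xs, \<sigma>) \<Rightarrow> cycle_of_list xs \<circ> \<sigma>) = \<tau>"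
      using eq by (simp del: set_map)
    show "(support \<tau> i, ?res \<tau>) \<in> ?S"
      using support_in_cycles_at[OF \<tau> fin i] semidecomposition[OF \<tau> fin] by blast
    show "(case (support \<tau> i, ?res \<tau>) of (xs, \<sigma>) \<Rightarrow> g (cycle_of_list xs \<circ> \<sigma>)) = g \<tau>"
      using eq by (simp del: set_map)
  next
    fix b assume "b \<in> ?S"
    then obtain xs \<sigma> where b: "b = (xs, \<sigma>)" and xs: "distinct xs" "xs \<noteq> []" "set xs \<subseteq> \<beta>" "hd xs = i"
      and \<sigma>: "\<sigma> permutes (\<beta> - set xs)"
      by (auto simp: cycles_at_def)
    have disj: "set xs \<inter> (\<beta> - set xs) = {}" by blast
    note facts = support_cycle_comp_hd[OF xs(1,2) \<sigma> disj] cycle_comp_outside[OF xs(1,2) \<sigma> disj]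
    have "?res (cycle_of_list xs \<circ> \<sigma>) = \<sigma>"
      using facts xs(4) permutes_not_in[OF \<sigma>] by (auto simp: fun_eq_iff simp del: set_map)
    then show "(support (case b of (xs, \<sigma>) \<Rightarrow> cycle_of_list xs \<circ> \<sigma>) i,
          ?res (case b of (xs, \<sigma>) \<Rightarrow> cycle_of_list xs \<circ> \<sigma>)) = b"
      using facts(1) unfolding xs(4) b prod.case by (simp only:)
    show "(case b of (xs, \<sigma>) \<Rightarrow> cycle_of_list xs \<circ> \<sigma>) \<in> {\<tau>. \<tau> permutes \<beta>}"
      using cycle_comp_permutes[OF xs(1,2) \<sigma> disj] xs(3) by (simp add: b Un_absorb1)
  qed
  also have "\<dots> = (\<Sum>xs\<in>cycles_at \<beta> i. \<Sum>\<sigma> | \<sigma> permutes (\<beta> - set xs). g (cycle_of_list xs \<circ> \<sigma>))"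
    by (rule sum.Sigma[symmetric]) (use fin in \<open>auto intro: finite_cycles_at finite_permutations\<close>)
  finally show ?thesis .
qed

text \<open>The cycle containing \<open>Min \<gamma>\<close> ends with \<open>Min \<gamma>\<close>
  under both conventions. As the least of all cycle minima it comes last in the decreasing list,
  exactly where \<open>cycle_ends\<close> appends its distinguished index.\<close>

lemma ends_Min:
  assumes fin: "finite \<gamma>" and ne: "\<gamma> \<noteq> {}" and \<sigma>: "\<sigma> permutes \<gamma>"
  shows "cycle_ends \<gamma> (Min \<gamma>) \<sigma> = ends \<gamma> \<sigma>"
proof -
  let ?m = "Min \<gamma>"
  let ?A = "{s \<in> \<gamma>. s = Min (set (support \<sigma> s))}"
  let ?A' = "{s \<in> \<gamma>. ?m \<notin> set (support \<sigma> s) \<and> s = Min (set (support \<sigma> s))}"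
  have p: "permutation \<sigma>" using \<sigma> fin permutation_permutes by blast
  have m: "?m \<in> \<gamma>" using fin ne by simp
  have Min_supp: "Min (set (support \<sigma> s)) = ?m" if "?m \<in> set (support \<sigma> s)" "s \<in> \<gamma>" for s
  proof (rule Min_eqI)
    show "finite (set (support \<sigma> s))" by simp
    show "?m \<le> y" if y: "y \<in> set (support \<sigma> s)" for y
      using set_support_subset[OF \<sigma> \<open>s \<in> \<gamma>\<close>] y fin by (intro Min_le) blast+
  qed (rule that(1))
  have mA: "?m \<in> ?A" using m Min_supp[OF mem_support_self[OF p] m] by simp
  have "Min ?A = ?m"
    by (rule Min_eqI) (use fin mA in auto)
  moreover have "?A - {?m} = ?A'"
  proof (intro Set.set_eqI iffI)
    fix s assume "s \<in> ?A - {?m}"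
    then have s: "s \<in> \<gamma>" "s = Min (set (support \<sigma> s))" "s \<noteq> ?m" by blast+
    then have "?m \<notin> set (support \<sigma> s)" using Min_supp[of s] by argo
    then show "s \<in> ?A'" using s by blast
  next
    fix s assume "s \<in> ?A'"
    then have s: "s \<in> \<gamma>" "s = Min (set (support \<sigma> s))" "?m \<notin> set (support \<sigma> s)" by blast+
    have "s \<noteq> ?m" using s(3) mem_support_self[OF p, of s] by metis
    then show "s \<in> ?A - {?m}" using s by blast
  qed
  ultimately have "sorted_list_of_set ?A = ?m # sorted_list_of_set ?A'"
    using sorted_list_of_set_nonempty[of ?A] fin mA by fastforce
  then show ?thesis unfolding ends_def cycle_ends_def by simp
qed

lemma pdet_conv_ends:
  assumes "finite \<gamma>"
  shows "pdet \<gamma> B = (\<Sum>\<sigma> | \<sigma> permutes \<gamma>.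
    (- 1) ^ (card \<gamma> - length (ends \<gamma> \<sigma>)) * prod_list (map (cycle_prod B \<sigma>) (ends \<gamma> \<sigma>)))"
proof (cases "\<gamma> = {}")
  case True
  then show ?thesis by (simp add: pdet_def ends_def)
next
  case False
  then show ?thesis using ends_Min[OF assms False] by (simp add: pdet_def cdet_def)
qed

text \<open>Cycles avoiding \<open>i\<close> lie in the complement of \<open>xs\<close> and are
  cycles of \<sigma>, so their ends are those of \<sigma>.\<close>

lemma cycle_ends_cycle_comp:
  assumes fin: "finite \<beta>" and xs: "xs \<in> cycles_at \<beta> i" and \<sigma>: "\<sigma> permutes (\<beta> - set xs)"
  shows "cycle_ends \<beta> i (cycle_of_list xs \<circ> \<sigma>) = ends (\<beta> - set xs) \<sigma> @ [i]"
proof -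
  let ?\<tau> = "cycle_of_list xs \<circ> \<sigma>"
  have xs': "distinct xs" "xs \<noteq> []" "set xs \<subseteq> \<beta>" "hd xs = i" using xs by (auto simp: cycles_at_def)
  have disj: "set xs \<inter> (\<beta> - set xs) = {}" by blast
  have \<tau>: "?\<tau> permutes \<beta>"
    using cycle_comp_permutes[OF xs'(1,2) \<sigma> disj] xs'(3) by (simp add: Un_absorb1)
  then have p: "permutation ?\<tau>" using fin permutation_permutes by blast
  have supp_i: "set (support ?\<tau> i) = set xs"
    using support_cycle_comp_hd[OF xs'(1,2) \<sigma> disj] unfolding xs'(4) by (simp only:)
  have in_iff: "i \<in> set (support ?\<tau> s) \<longleftrightarrow> s \<in> set xs" for s
    using disjoint_support'[OF p, of i s] disjoint_support'[OF p, of s i] unfolding supp_i by blast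
  have out: "support ?\<tau> s = support \<sigma> s" if "s \<in> \<beta> - set xs" for s
    using support_cycle_comp_outside[OF xs'(1,2) \<sigma> disj that] .
  have "{s \<in> \<beta>. i \<notin> set (support ?\<tau> s) \<and> s = Min (set (support ?\<tau> s))} =
      {s \<in> \<beta> - set xs. s = Min (set (support \<sigma> s))}"
    unfolding in_iff using out by (metis (no_types, lifting) DiffD1 DiffD2 DiffI)
  then show ?thesis unfolding cycle_ends_def ends_def by simp
qed

lemma prod_list_rotate1:
  assumes "xs \<noteq> []" "map \<tau> xs = rotate1 xs"
  shows "prod_list (map (\<lambda>a. B $$ (a, \<tau> a)) xs) = path_prod B xs * B $$ (last xs, hd xs)"
proof -
  have gen: "map \<tau> (x # ys) = ys @ [z] \<Longrightarrow>
      prod_list (map (\<lambda>a. B $$ (a, \<tau> a)) (x # ys)) = path_prod B (x # ys) * B $$ (last (x # ys), z)"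
    for x z ys
    by (induction ys arbitrary: x) (auto simp: mult.assoc)
  from assms gen show ?thesis by (cases xs) auto
qed

text \<open>The cycle through \<open>i\<close> is the rightmost factor of each term, so summing over
  the remaining permutation produces the complementary minor on the left without commuting any
  entries. The sign splits accordingly.\<close>

lemma cdet_conv_cycles_at:
  assumes fin: "finite \<beta>" and i: "i \<in> \<beta>"
  shows "cdet \<beta> i B = (\<Sum>xs\<in>cycles_at \<beta> i.
    (- 1) ^ (length xs - 1) * pdet (\<beta> - set xs) B * (path_prod B xs * B $$ (last xs, i)))"
  unfolding cdet_def sum_permutes_cycles_at[OF assms]
proof (rule sum.cong[OF refl])
  fix xs assume xs: "xs \<in> cycles_at \<beta> i"
  then have xs': "distinct xs" "xs \<noteq> []" "set xs \<subseteq> \<beta>" "hd xs = i" by (auto simp: cycles_at_def)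
  let ?\<gamma> = "\<beta> - set xs"
  have disj: "set xs \<inter> ?\<gamma> = {}" by blast
  have fin\<gamma>: "finite ?\<gamma>" using fin by simp
  have "(\<Sum>\<sigma> | \<sigma> permutes ?\<gamma>.
       (- 1) ^ (card \<beta> - length (cycle_ends \<beta> i (cycle_of_list xs \<circ> \<sigma>))) *
       prod_list (map (cycle_prod B (cycle_of_list xs \<circ> \<sigma>)) (cycle_ends \<beta> i (cycle_of_list xs \<circ> \<sigma>)))) =
    (\<Sum>\<sigma> | \<sigma> permutes ?\<gamma>. (- 1) ^ (length xs - 1) *
      ((- 1) ^ (card ?\<gamma> - length (ends ?\<gamma> \<sigma>)) * prod_list (map (cycle_prod B \<sigma>) (ends ?\<gamma> \<sigma>))) *
      (path_prod B xs * B $$ (last xs, i)))"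
  proof (rule sum.cong[OF refl])
    fix \<sigma> assume "\<sigma> \<in> {\<sigma>. \<sigma> permutes ?\<gamma>}"
    then have \<sigma>: "\<sigma> permutes ?\<gamma>" by simp
    let ?\<tau> = "cycle_of_list xs \<circ> \<sigma>"
    have cyc_i: "cycle_prod B ?\<tau> i = path_prod B xs * B $$ (last xs, i)"
      using support_cycle_comp_hd[OF xs'(1,2) \<sigma> disj] map_cycle_comp[OF xs'(1,2) \<sigma> disj]
        prod_list_rotate1[OF xs'(2), of ?\<tau> B] xs'(4)
      unfolding cycle_prod_def by metis
    have cyc_s: "cycle_prod B ?\<tau> s = cycle_prod B \<sigma> s" if "s \<in> ?\<gamma>" for s
    proof -
      have "?\<tau> a = \<sigma> a" if "a \<in> set (support \<sigma> s)" for a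
        using set_support_subset[OF \<sigma> \<open>s \<in> ?\<gamma>\<close>] that cycle_comp_outside[OF xs'(1,2) \<sigma> disj] by blast
      then show ?thesis
        unfolding cycle_prod_def support_cycle_comp_outside[OF xs'(1,2) \<sigma> disj that]
        by (metis (mono_tags, lifting) map_cong)
    qed
    have sub: "set (ends ?\<gamma> \<sigma>) \<subseteq> ?\<gamma>" using fin\<gamma> by (auto simp: ends_def)
    have "length (ends ?\<gamma> \<sigma>) = card {s \<in> ?\<gamma>. s = Min (set (support \<sigma> s))}"
      by (simp only: ends_def length_rev length_sorted_list_of_set)
    also have "\<dots> \<le> card ?\<gamma>" using fin\<gamma> by (intro card_mono) auto
    finally have le: "length (ends ?\<gamma> \<sigma>) \<le> card ?\<gamma>" .
    have "card \<beta> = card ?\<gamma> + length xs"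
      using card_Diff_subset[of "set xs" \<beta>] xs' fin card_mono[OF fin xs'(3)]
      by (simp add: distinct_card)
    moreover have "length xs \<ge> 1" using xs'(2) by (cases xs) auto
    \<comment> \<open>The subtraction is truncated; \<open>le\<close> ensures that there are at most
      as many remaining cycles as remaining elements.\<close>
    ultimately have exp: "card \<beta> - length (ends ?\<gamma> \<sigma> @ [i]) =
        (length xs - 1) + (card ?\<gamma> - length (ends ?\<gamma> \<sigma>))"
      using le by simp
    have "map (cycle_prod B ?\<tau>) (ends ?\<gamma> \<sigma>) = map (cycle_prod B \<sigma>) (ends ?\<gamma> \<sigma>)"
      using cyc_s sub by (intro map_cong) auto
    then show "(- 1) ^ (card \<beta> - length (cycle_ends \<beta> i ?\<tau>)) *
        prod_list (map (cycle_prod B ?\<tau>) (cycle_ends \<beta> i ?\<tau>)) =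
      (- 1) ^ (length xs - 1) * ((- 1) ^ (card ?\<gamma> - length (ends ?\<gamma> \<sigma>)) *
        prod_list (map (cycle_prod B \<sigma>) (ends ?\<gamma> \<sigma>))) * (path_prod B xs * B $$ (last xs, i))"
      unfolding cycle_ends_cycle_comp[OF fin xs \<sigma>] exp
      by (simp only: map_append prod_list.append list.map prod_list.Cons prod_list.Nil cyc_i power_add
        mult.assoc mult_1_right)
  qed
  then show "(\<Sum>\<sigma> | \<sigma> permutes ?\<gamma>.
       (- 1) ^ (card \<beta> - length (cycle_ends \<beta> i (cycle_of_list xs \<circ> \<sigma>))) *
       prod_list (map (cycle_prod B (cycle_of_list xs \<circ> \<sigma>)) (cycle_ends \<beta> i (cycle_of_list xs \<circ> \<sigma>)))) =
     (- 1) ^ (length xs - 1) * pdet ?\<gamma> B * (path_prod B xs * B $$ (last xs, i))"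
    unfolding pdet_conv_ends[OF fin\<gamma>] by (simp add: sum_distrib_left sum_distrib_right)
qed

section \<open>Dependence on the entries and on a replaced column\<close>

lemma cdet_cong:
  assumes "\<And>a b. a \<in> \<beta> \<Longrightarrow> b \<in> \<beta> \<Longrightarrow> B $$ (a, b) = B' $$ (a, b)" "j \<in> \<beta>" "finite \<beta>"
  shows "cdet \<beta> j B = cdet \<beta> j B'"
  unfolding cdet_def
proof (intro sum.cong refl arg_cong2[where f = times] arg_cong[where f = prod_list] map_cong)
  fix \<tau> s assume "\<tau> \<in> {\<tau>. \<tau> permutes \<beta>}" and s: "s \<in> set (cycle_ends \<beta> j \<tau>)"
  then have \<tau>: "\<tau> permutes \<beta>" by simp
  have "s \<in> \<beta>" using s assms(2,3) by (auto simp: cycle_ends_def)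
  then show "cycle_prod B \<tau> s = cycle_prod B' \<tau> s"
    unfolding cycle_prod_def
    using set_support_subset[OF \<tau>] permutes_in_image[OF \<tau>] assms(1)
    by (intro arg_cong[where f = prod_list] map_cong refl) blast
qed

lemma pdet_cong:
  assumes "\<And>a b. a \<in> \<gamma> \<Longrightarrow> b \<in> \<gamma> \<Longrightarrow> B $$ (a, b) = B' $$ (a, b)" "finite \<gamma>"
  shows "pdet \<gamma> B = pdet \<gamma> B'"
  using assms cdet_cong[of \<gamma> B B' "Min \<gamma>"] by (simp add: pdet_def)

lemma path_prod_append: "path_prod B (xs @ c # ys) = path_prod B (xs @ [c]) * path_prod B (c # ys)"
  by (induction xs rule: path_prod.induct[where ?a0.0 = B for B, case_names Cons2 Nil Single])
    (simp_all add: mult.assoc)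

lemma path_prod_snoc: "xs \<noteq> [] \<Longrightarrow> path_prod B (xs @ [c]) = path_prod B xs * B $$ (last xs, c)"
  using path_prod_append[of B _ _ "[c]"] by (cases xs rule: rev_cases) auto

lemma cdet_path_prod:
  assumes "finite \<beta>" "i \<in> \<beta>"
  shows "cdet \<beta> i B = (\<Sum>xs\<in>cycles_at \<beta> i.
    (- 1) ^ (length xs - 1) * pdet (\<beta> - set xs) B * path_prod B (xs @ [i]))"
  unfolding cdet_conv_cycles_at[OF assms]
  by (intro sum.cong refl) (simp add: cycles_at_def path_prod_snoc)

text \<open>The cycle expansion of \<open>cdet\<close> with the closing entry turned into a weight
  \<open>w\<close> on the last index. Varying \<open>w\<close> with \<open>H\<close> fixed models
  the replacement of column \<open>i\<close>.\<close>

definition path_sum :: "'a::ring_1 mat \<Rightarrow> nat set \<Rightarrow> nat \<Rightarrow> (nat \<Rightarrow> 'a) \<Rightarrow> 'a" where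
  "path_sum H \<beta> i w = (\<Sum>xs\<in>cycles_at \<beta> i.
    (- 1) ^ (length xs - 1) * pdet (\<beta> - set xs) H * (path_prod H xs * w (last xs)))"

lemma cdet_conv_path_sum:
  assumes "finite \<beta>" "i \<in> \<beta>"
  shows "cdet \<beta> i B = path_sum B \<beta> i (\<lambda>a. B $$ (a, i))"
  unfolding cdet_conv_cycles_at[OF assms] path_sum_def ..

lemma path_prod_cong:
  assumes "\<And>a b. a \<in> set xs \<Longrightarrow> b \<in> set (tl xs) \<Longrightarrow> B $$ (a, b) = B' $$ (a, b)"
  shows "path_prod B xs = path_prod B' xs"
  using assms
proof (induction xs rule: induct_list012)
  case (3 a b xs)
  have "path_prod B (b # xs) = path_prod B' (b # xs)"
    using 3(3) by (intro 3(2)) auto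
  then show ?case using 3(3)[of a b] by simp
qed simp_all

text \<open>Since \<open>i\<close> is the head of its cycle, neither the open path nor the
  complementary minor reads column \<open>i\<close>; only the closing entry does.\<close>

lemma cdet_replace_col:
  assumes H: "H \<in> carrier_mat n n" and \<beta>: "\<beta> \<subseteq> {..<n}" and i: "i \<in> \<beta>"
  shows "cdet \<beta> i (replace_col H v i) = path_sum H \<beta> i (($) v)"
proof -
  have fin: "finite \<beta>" using \<beta> finite_subset by blast
  let ?B = "replace_col H v i"
  have B: "?B $$ (a, b) = (if b = i then v $ a else H $$ (a, b))" if "a \<in> \<beta>" "b \<in> \<beta>" for a b
    using subsetD[OF \<beta> that(1)] subsetD[OF \<beta> that(2)] H by (auto simp: replace_col_def)
  show ?thesis
    unfolding cdet_conv_path_sum[OF fin i] path_sum_def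
  proof (intro sum.cong refl)
    fix xs assume "xs \<in> cycles_at \<beta> i"
    then have xs: "distinct xs" "xs \<noteq> []" "set xs \<subseteq> \<beta>" "hd xs = i" by (auto simp: cycles_at_def)
    have i_xs: "i \<in> set xs" using xs by auto
    have "pdet (\<beta> - set xs) ?B = pdet (\<beta> - set xs) H"
      using fin i_xs by (intro pdet_cong) (auto simp: B)
    moreover have tl: "i \<notin> set (tl xs)" "set (tl xs) \<subseteq> \<beta>" using xs by (cases xs; auto)+
    have "path_prod ?B xs = path_prod H xs"
    proof (rule path_prod_cong)
      fix a b assume "a \<in> set xs" "b \<in> set (tl xs)"
      then have "a \<in> \<beta>" "b \<in> \<beta>" "b \<noteq> i" using xs(3) tl by blast+
      then show "?B $$ (a, b) = H $$ (a, b)" by (simp add: B)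
    qed
    moreover have "?B $$ (last xs, i) = v $ last xs"
      using xs i by (auto simp: B subset_iff)
    ultimately show "(- 1) ^ (length xs - 1) * pdet (\<beta> - set xs) ?B * (path_prod ?B xs * ?B $$ (last xs, i)) =
      (- 1) ^ (length xs - 1) * pdet (\<beta> - set xs) H * (path_prod H xs * v $ last xs)"
      by simp
  qed
qed

text \<open>Apart from the 1-cycle, deleting the head \<open>i\<close> leaves a list of the same
  kind over the smaller set, starting at the successor \<open>u\<close> of \<open>i\<close>.\<close>

lemma sum_cycles_at_Cons:
  assumes fin: "finite \<beta>" and i: "i \<in> \<beta>"
  shows "(\<Sum>xs\<in>cycles_at \<beta> i. g xs) =
    g [i] + (\<Sum>u\<in>\<beta> - {i}. \<Sum>xs\<in>cycles_at (\<beta> - {i}) u. g (i # xs))"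
proof -
  let ?S = "SIGMA u:\<beta> - {i}. cycles_at (\<beta> - {i}) u"
  have "cycles_at \<beta> i = insert [i] (cycles_at \<beta> i - {[i]})"
    using i by (auto simp: cycles_at_def)
  then have "(\<Sum>xs\<in>cycles_at \<beta> i. g xs) = g [i] + (\<Sum>xs\<in>cycles_at \<beta> i - {[i]}. g xs)"
    using finite_cycles_at[OF fin, of i] by (metis finite_Diff sum.insert Diff_iff insertI1)
  also have "(\<Sum>xs\<in>cycles_at \<beta> i - {[i]}. g xs) = (\<Sum>(u, xs)\<in>?S. g (i # xs))"
  proof (rule sum.reindex_bij_witness[where i = "\<lambda>(u, xs). i # xs" and j = "\<lambda>xs. (hd (tl xs), tl xs)"])
    fix xs assume "xs \<in> cycles_at \<beta> i - {[i]}"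
    then have xs: "distinct xs" "set xs \<subseteq> \<beta>" "xs \<noteq> []" "hd xs = i" "xs \<noteq> [i]" by (auto simp: cycles_at_def)
    then obtain u ys where eq: "xs = i # u # ys" by (metis list.collapse)
    show "(hd (tl xs), tl xs) \<in> ?S" using xs unfolding eq by (auto simp: cycles_at_def)
    show "(case (hd (tl xs), tl xs) of (u, xs) \<Rightarrow> i # xs) = xs"
      "(case (hd (tl xs), tl xs) of (u, xs) \<Rightarrow> g (i # xs)) = g xs"
      by (simp_all add: eq)
  qed (use i in \<open>auto simp: cycles_at_def\<close>)
  also have "\<dots> = (\<Sum>u\<in>\<beta> - {i}. \<Sum>xs\<in>cycles_at (\<beta> - {i}) u. g (i # xs))"
    by (rule sum.Sigma[symmetric]) (use fin in \<open>auto intro: finite_cycles_at\<close>)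
  finally show ?thesis .
qed

text \<open>The weight is the rightmost factor, so the sum is right-linear in \<open>w\<close>. Its
  values at unit weights later serve as matrix entries.\<close>

lemma path_sum_linear:
  assumes "finite \<beta>"
  shows "path_sum H \<beta> i w = (\<Sum>j\<in>\<beta>. path_sum H \<beta> i (\<lambda>a. if a = j then 1 else 0) * w j)"
proof -
  have "(\<Sum>j\<in>\<beta>. path_sum H \<beta> i (\<lambda>a. if a = j then 1 else 0) * w j) =
    (\<Sum>xs\<in>cycles_at \<beta> i. \<Sum>j\<in>\<beta>. if last xs = j then
       (- 1) ^ (length xs - 1) * pdet (\<beta> - set xs) H * (path_prod H xs * w j) else 0)"
    unfolding path_sum_def sum_distrib_right
    by (subst sum.swap) (intro sum.cong refl, auto simp: mult.assoc)
  also have "\<dots> = path_sum H \<beta> i w"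
    unfolding path_sum_def
    by (intro sum.cong refl) (use assms in \<open>auto simp: cycles_at_def subset_iff\<close>)
  finally show ?thesis ..
qed

text \<open>By distinctness only the list \<open>[i]\<close> both starts and ends at
  \<open>i\<close>.\<close>

lemma path_sum_unit_self:
  assumes "finite \<beta>" "i \<in> \<beta>"
  shows "path_sum H \<beta> i (\<lambda>a. if a = i then 1 else 0) = pdet (\<beta> - {i}) H"
proof -
  have "last (i # xs) \<noteq> i" if "xs \<in> cycles_at (\<beta> - {i}) u" for xs u
  proof -
    have "xs \<noteq> []" "last xs \<in> \<beta> - {i}"
      using that last_in_set[of xs] unfolding cycles_at_def by blast+
    then show ?thesis by auto
  qed
  then show ?thesis
    unfolding path_sum_def sum_cycles_at_Cons[OF assms] by simp
qed

lemma path_sum_unit_outside: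
  assumes "j \<notin> \<beta>"
  shows "path_sum H \<beta> i (\<lambda>a. if a = j then 1 else 0) = 0"
  unfolding path_sum_def using assms
  by (intro sum.neutral ballI) (auto simp: cycles_at_def subset_iff)

text \<open>A path ending in the new index \<open>j\<close> is a path in \<beta> followed by
  \<open>j\<close>. The complement is the same, and the extra step flips the sign. This drives the
  off-diagonal cancellation in \<open>adj_recursion\<close>.\<close>

lemma path_sum_unit_insert:
  assumes fin: "finite \<beta>" and i: "i \<in> \<beta>" and j: "j \<notin> \<beta>"
  shows "path_sum H (insert j \<beta>) i (\<lambda>a. if a = j then 1 else 0) = - path_sum H \<beta> i (\<lambda>a. H $$ (a, j))"
proof -
  let ?f = "\<lambda>xs. (- 1) ^ (length xs - 1) * pdet (insert j \<beta> - set xs) H *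
    (path_prod H xs * (if last xs = j then 1 else 0))"
  have "(\<Sum>xs\<in>cycles_at (insert j \<beta>) i. ?f xs) = (\<Sum>xs | xs \<in> cycles_at (insert j \<beta>) i \<and> last xs = j. ?f xs)"
    using finite_cycles_at[of "insert j \<beta>"] fin by (intro sum.mono_neutral_right) auto
  also have "\<dots> = (\<Sum>xs\<in>cycles_at \<beta> i. - ((- 1) ^ (length xs - 1) * pdet (\<beta> - set xs) H *
      (path_prod H xs * H $$ (last xs, j))))"
  proof (rule sum.reindex_bij_witness[where i = "\<lambda>xs. xs @ [j]" and j = butlast])
    fix xs assume "xs \<in> {xs. xs \<in> cycles_at (insert j \<beta>) i \<and> last xs = j}"
    then have xs: "distinct xs" "set xs \<subseteq> insert j \<beta>" "xs \<noteq> []" "hd xs = i" "last xs = j"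
      by (auto simp: cycles_at_def)
    then obtain ys where ys: "xs = ys @ [j]" by (metis append_butlast_last_id)
    \<comment> \<open>The head \<open>i\<close> lies in \<beta> and \<open>j\<close> does not, so a
      nonempty path precedes \<open>j\<close> and the exponents differ by exactly one.\<close>
    have ne: "ys \<noteq> []" using xs i j ys by auto
    then have len: "length ys = Suc (length ys - 1)" by (cases ys) auto
    show "butlast xs @ [j] = xs" using ys by simp
    show "butlast xs \<in> cycles_at \<beta> i"
      using xs ne unfolding ys by (auto simp: cycles_at_def)
    have "insert j \<beta> - set xs = \<beta> - set ys" using j ys by auto
    moreover have "(- 1) ^ (length xs - 1) = - ((- 1) ^ (length ys - 1) :: 'a)"
      using len ys by (metis butlast_snoc length_butlast power_Suc mult_minus1)
    ultimately show "- ((- 1) ^ (length (butlast xs) - 1) * pdet (\<beta> - set (butlast xs)) H *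
      (path_prod H (butlast xs) * H $$ (last (butlast xs), j))) = ?f xs"
      using ne by (simp add: ys path_prod_snoc)
  next
    fix xs assume "xs \<in> cycles_at \<beta> i"
    then show "butlast (xs @ [j]) = xs" "xs @ [j] \<in> {xs. xs \<in> cycles_at (insert j \<beta>) i \<and> last xs = j}"
      using j by (auto simp: cycles_at_def)
  qed
  finally show ?thesis unfolding path_sum_def by (simp add: sum_negf)
qed

section \<open>Quaternions\<close>

lemma qre_add [simp]: "qre (x + y) = qre x + qre y"
  and qre_0 [simp]: "qre 0 = 0"
  and qre_1 [simp]: "qre 1 = 1"
  and qre_of_real [simp]: "qre (of_real r) = r"
  by (simp_all add: plus_quat_def uminus_quat_def minus_quat_def zero_quat_def one_quat_def of_real_quat)

lemma qre_sum: "qre (\<Sum>a\<in>S. f a) = (\<Sum>a\<in>S. qre (f a))"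
  by (induction S rule: infinite_finite_induct) auto

text \<open>The substitute for commutativity: it allows cyclic rotation of products under
  \<open>qre\<close>, both for cycles and for traces.\<close>

lemma qre_mult_commute: "qre (x * y) = qre (y * x)"
  by (simp add: times_quat_def)

lemma qre_of_real_mult: "qre (of_real r * x) = r * qre x"
  by (simp add: times_quat_def of_real_quat)

lemma of_real_commute: "of_real r * x = x * (of_real r :: quat)"
  by (simp add: times_quat_def of_real_quat)

lemma of_real_left_commute: "x * (of_real r * y) = of_real r * (x * (y :: quat))"
  by (metis mult.assoc of_real_commute)

lemma qcnj_qcnj [simp]: "qcnj (qcnj x) = x"
  by (simp add: qcnj_def)

lemma qcnj_add: "qcnj (x + y) = qcnj x + qcnj y"
  by (simp add: qcnj_def plus_quat_def)

lemma qcnj_diff: "qcnj (x - y) = qcnj x - qcnj y"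
  by (simp add: qcnj_def minus_quat_def)

lemma qcnj_0 [simp]: "qcnj 0 = 0"
  and qcnj_1 [simp]: "qcnj 1 = 1"
  and qcnj_of_real [simp]: "qcnj (of_real r) = of_real r"
  by (simp_all add: qcnj_def zero_quat_def one_quat_def of_real_quat)

lemma qcnj_mult: "qcnj (x * y) = qcnj y * qcnj x"
  by (simp add: qcnj_def times_quat_def algebra_simps)

lemma qcnj_sum: "qcnj (\<Sum>a\<in>S. f a) = (\<Sum>a\<in>S. qcnj (f a))"
  by (induction S rule: infinite_finite_induct) (auto simp: qcnj_add)

lemma qcnj_fixed_imp_real: "qcnj x = x \<Longrightarrow> x = of_real (qre x)"
  by (cases x) (simp add: qcnj_def of_real_quat)

lemma minus_one_power_of_real: "(- 1) ^ k = (of_real ((- 1) ^ k) :: quat)"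
  by simp

section \<open>Column determinants of Hermitian matrices\<close>

locale hermitian_matrix =
  fixes H :: "quat mat" and n :: nat
  assumes carrier: "H \<in> carrier_mat n n" and herm: "hermitian H"
begin

lemma qcnj_entry: "i < n \<Longrightarrow> j < n \<Longrightarrow> qcnj (H $$ (i, j)) = H $$ (j, i)"
proof -
  assume ij: "i < n" "j < n"
  have "conj_transpose H $$ (j, i) = H $$ (j, i)" using herm by (simp add: hermitian_def)
  then show ?thesis using ij carrier by (simp add: conj_transpose_def)
qed

text \<open>Conjugation reverses the order of the factors and transposes each entry, so the path is
  traversed backwards.\<close>

lemma qcnj_path_prod:
  assumes "set xs \<subseteq> {..<n}"
  shows "qcnj (path_prod H xs) = path_prod H (rev xs)"
  using assms
proof (induction xs rule: induct_list012)
  case (3 a b xs)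
  then show ?case
    using path_prod_append[of H "rev xs" b "[a]"] qcnj_entry[of a b] by (simp add: qcnj_mult)
qed simp_all

text \<open>Reversing the cycle through \<open>i\<close> conjugates its contribution.\<close>

lemma qcnj_cdet:
  assumes \<beta>: "\<beta> \<subseteq> {..<n}" and i: "i \<in> \<beta>"
    and real: "\<And>\<gamma>. \<gamma> \<subset> \<beta> \<Longrightarrow> pdet \<gamma> H = of_real (qre (pdet \<gamma> H))"
  shows "qcnj (cdet \<beta> i H) = cdet \<beta> i H"
proof -
  have fin: "finite \<beta>" using \<beta> finite_subset by blast
  let ?t = "\<lambda>xs. (- 1) ^ (length xs - 1) * pdet (\<beta> - set xs) H * path_prod H (xs @ [i])"
  \<comment> \<open>This map keeps the starting point and reverses the direction of the
    cycle.\<close>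
  let ?\<phi> = "\<lambda>xs. hd xs # rev (tl xs)"
  have "qcnj (\<Sum>xs\<in>cycles_at \<beta> i. ?t xs) = (\<Sum>xs\<in>cycles_at \<beta> i. qcnj (?t xs))"
    by (rule qcnj_sum)
  also have "\<dots> = (\<Sum>xs\<in>cycles_at \<beta> i. ?t xs)"
  proof (rule sum.reindex_bij_witness[where i = ?\<phi> and j = ?\<phi>])
    have "?\<phi> xs \<in> cycles_at \<beta> i \<and> ?\<phi> (?\<phi> xs) = xs" if "xs \<in> cycles_at \<beta> i" for xs
      using that by (cases xs) (auto simp: cycles_at_def)
    then show "?\<phi> xs \<in> cycles_at \<beta> i" "?\<phi> (?\<phi> xs) = xs"
      "?\<phi> xs \<in> cycles_at \<beta> i" "?\<phi> (?\<phi> xs) = xs" if "xs \<in> cycles_at \<beta> i" for xs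
      using that by blast+
    fix xs assume "xs \<in> cycles_at \<beta> i"
    then have xs: "distinct xs" "xs \<noteq> []" "set xs \<subseteq> \<beta>" "hd xs = i" by (auto simp: cycles_at_def)
    then obtain ys where ys: "xs = i # ys" by (metis list.collapse)
    have "\<beta> - set xs \<subset> \<beta>" using i ys by auto
    from real[OF this] obtain d where d: "pdet (\<beta> - set xs) H = of_real d" ..
    have "qcnj (path_prod H (xs @ [i])) = path_prod H (?\<phi> xs @ [i])"
      using qcnj_path_prod[of "xs @ [i]"] xs(3) \<beta> i by (auto simp: ys)
    \<comment> \<open>Sign and complementary minor form a real, hence central, factor that depends
      only on the set and the length of the cycle.\<close>
    moreover have "?t zs = of_real ((- 1) ^ (length xs - 1) * d) * path_prod H (zs @ [i])"
      if "set zs = set xs" "length zs = length xs" for zs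
      by (simp add: that d)
    moreover have "set (?\<phi> xs) = set xs" "length (?\<phi> xs) = length xs" by (simp_all add: ys)
    ultimately show "?t (?\<phi> xs) = qcnj (?t xs)"
      by (metis qcnj_mult qcnj_of_real of_real_commute)
  qed
  finally show ?thesis unfolding cdet_path_prod[OF fin i] .
qed

text \<open>If the cycle through \<open>i\<close> contains \<open>j\<close>, rotate it to start at \<open>j\<close>; otherwise expand the complementary
  minor along \<open>j\<close> and exchange the two disjoint cycles.\<close>

lemma qre_cdet_eq:
  assumes \<beta>: "\<beta> \<subseteq> {..<n}" and i: "i \<in> \<beta>" and j: "j \<in> \<beta>" and ij: "i \<noteq> j"
    and IH: "\<And>\<gamma> k. \<gamma> \<subset> \<beta> \<Longrightarrow> k \<in> \<gamma> \<Longrightarrow> cdet \<gamma> k H = pdet \<gamma> H"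
    and real: "\<And>\<gamma>. \<gamma> \<subset> \<beta> \<Longrightarrow> pdet \<gamma> H = of_real (qre (pdet \<gamma> H))"
  shows "qre (cdet \<beta> i H) = qre (cdet \<beta> j H)"
proof -
  have fin: "finite \<beta>" using \<beta> finite_subset by blast
  \<comment> \<open>Because the smaller minors are real, the real part of each term is a product of
    three real numbers: sign, complementary minor, and real part of the closed path product.\<close>
  define s :: "nat list \<Rightarrow> real" where "s xs = (- 1) ^ (length xs - 1)" for xs
  define d where "d \<gamma> = qre (pdet \<gamma> H)" for \<gamma>
  define q where "q xs = qre (path_prod H (xs @ [hd xs]))" for xs
  have expand: "qre (cdet \<gamma> k H) = (\<Sum>xs\<in>cycles_at \<gamma> k. s xs * d (\<gamma> - set xs) * q xs)"
    if "\<gamma> \<subseteq> \<beta>" "k \<in> \<gamma>" for \<gamma> k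
  proof -
    have fin': "finite \<gamma>" using that(1) fin finite_subset by blast
    show ?thesis
      unfolding cdet_path_prod[OF fin' that(2)] qre_sum
    proof (intro sum.cong refl)
      fix xs assume "xs \<in> cycles_at \<gamma> k"
      then have xs: "xs \<noteq> []" "hd xs = k" by (auto simp: cycles_at_def)
      then have "k \<in> set xs" by auto
      then have "\<gamma> - set xs \<subset> \<beta>" using that by blast
      from real[OF this] have "pdet (\<gamma> - set xs) H = of_real (d (\<gamma> - set xs))"
        unfolding d_def .
      then show "qre ((- 1) ^ (length xs - 1) * pdet (\<gamma> - set xs) H * path_prod H (xs @ [k])) =
          s xs * d (\<gamma> - set xs) * q xs"
        unfolding minus_one_power_of_real s_def q_def xs(2)
        by (simp only: qre_of_real_mult flip: of_real_mult)
    qed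
  qed
  \<comment> \<open>\<open>both k l\<close> collects the cycles through \<open>k\<close> that also
    meet \<open>l\<close>; \<open>pairs k l\<close> collects the pairs of disjoint cycles, one
    through each.\<close>
  define both where "both k l = (\<Sum>xs | xs \<in> cycles_at \<beta> k \<and> l \<in> set xs. s xs * d (\<beta> - set xs) * q xs)" for k l
  define pairs where "pairs k l = (SIGMA xs:{xs \<in> cycles_at \<beta> k. l \<notin> set xs}. cycles_at (\<beta> - set xs) l)" for k l
  have split: "qre (cdet \<beta> k H) = both k l +
      (\<Sum>(xs, ys)\<in>pairs k l. s xs * s ys * d (\<beta> - set xs - set ys) * (q xs * q ys))"
    if k: "k \<in> \<beta>" and l: "l \<in> \<beta>" for k l
  proof -
    have "qre (cdet \<beta> k H) = both k l +
        (\<Sum>xs | xs \<in> cycles_at \<beta> k \<and> l \<notin> set xs. s xs * d (\<beta> - set xs) * q xs)"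
      unfolding expand[OF subset_refl k] both_def
      by (subst sum.union_disjoint[symmetric])
        (use finite_cycles_at[OF fin, of k] in \<open>auto intro: sum.cong\<close>)
    also have "(\<Sum>xs | xs \<in> cycles_at \<beta> k \<and> l \<notin> set xs. s xs * d (\<beta> - set xs) * q xs) =
        (\<Sum>xs | xs \<in> cycles_at \<beta> k \<and> l \<notin> set xs. \<Sum>ys\<in>cycles_at (\<beta> - set xs) l.
          s xs * s ys * d (\<beta> - set xs - set ys) * (q xs * q ys))"
    proof (intro sum.cong refl)
      fix xs assume "xs \<in> {xs. xs \<in> cycles_at \<beta> k \<and> l \<notin> set xs}"
      then have xs: "xs \<noteq> []" "hd xs = k" "l \<in> \<beta> - set xs" using l by (auto simp: cycles_at_def)
      have "k \<in> set xs" using xs by auto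
      \<comment> \<open>By the induction hypothesis the complementary minor may be expanded along
        \<open>l\<close> instead of along its minimum.\<close>
      then have "d (\<beta> - set xs) = qre (cdet (\<beta> - set xs) l H)"
        unfolding d_def using k by (subst IH[OF _ xs(3)]) auto
      then show "s xs * d (\<beta> - set xs) * q xs = (\<Sum>ys\<in>cycles_at (\<beta> - set xs) l.
          s xs * s ys * d (\<beta> - set xs - set ys) * (q xs * q ys))"
        unfolding expand[OF Diff_subset xs(3)] by (simp add: sum_distrib_left sum_distrib_right mult_ac)
    qed
    also have "\<dots> = (\<Sum>(xs, ys)\<in>pairs k l. s xs * s ys * d (\<beta> - set xs - set ys) * (q xs * q ys))"
      unfolding pairs_def
      by (rule sum.Sigma) (use finite_cycles_at[OF fin, of k] fin in \<open>auto intro: finite_cycles_at\<close>)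
    finally show ?thesis .
  qed
  have "(\<Sum>(xs, ys)\<in>pairs i j. s xs * s ys * d (\<beta> - set xs - set ys) * (q xs * q ys)) =
      (\<Sum>(xs, ys)\<in>pairs j i. s xs * s ys * d (\<beta> - set xs - set ys) * (q xs * q ys))"
  proof -
    have pairs: "(xs, ys) \<in> pairs k l \<longleftrightarrow> xs \<in> cycles_at \<beta> k \<and> ys \<in> cycles_at \<beta> l \<and> set xs \<inter> set ys = {}"
      for xs ys k l
      using hd_in_set[of ys] by (auto simp: pairs_def cycles_at_def)
    show ?thesis
      by (rule sum.reindex_bij_witness[where i = prod.swap and j = prod.swap])
        (auto simp: pairs Diff_eq Int_ac Un_commute mult_ac)
  qed
  moreover have "both i j = both j i"
  proof -
    \<comment> \<open>\<open>rot l\<close> shifts a cycle so that it starts at \<open>l\<close>. The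
      two arcs between \<open>k\<close> and \<open>l\<close> then trade places in the product, which
      does not change the real part.\<close>
    define rot where "rot l xs = dropWhile (\<lambda>a. a \<noteq> l) xs @ takeWhile (\<lambda>a. a \<noteq> l) xs" for l :: nat and xs
    have rot: "rot l xs \<in> cycles_at \<beta> l \<and> k \<in> set (rot l xs) \<and> rot k (rot l xs) = xs \<and>
        s (rot l xs) = s xs \<and> set (rot l xs) = set xs \<and> q (rot l xs) = q xs"
      if xs: "xs \<in> cycles_at \<beta> k" "l \<in> set xs" and kl: "k \<noteq> l" for k l xs
    proof -
      from xs have xs': "distinct xs" "set xs \<subseteq> \<beta>" "xs \<noteq> []" "hd xs = k" by (auto simp: cycles_at_def)
      obtain as bs where ab: "xs = as @ l # bs" "l \<notin> set as" using split_list_first[OF xs(2)] by blast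
      then obtain cs where as: "as = k # cs" using xs' kl by (cases as) auto
      have rot_split: "rot c (us @ c # vs) = c # vs @ us" if "c \<notin> set us" for c us vs
      proof -
        from that have "dropWhile (\<lambda>a. a \<noteq> c) (us @ c # vs) = c # vs" "takeWhile (\<lambda>a. a \<noteq> c) (us @ c # vs) = us"
          by (induction us) auto
        then show ?thesis by (simp add: rot_def)
      qed
      have rot_l: "rot l xs = l # bs @ as" unfolding ab(1) by (rule rot_split[OF ab(2)])
      have "k \<notin> set (l # bs)" using xs'(1) kl by (auto simp: ab as)
      then have "rot k (rot l xs) = xs"
        unfolding rot_l using rot_split[of k "l # bs" cs] by (simp add: ab as)
      moreover have "q (rot l xs) = q xs"
      proof -
        have "path_prod H (rot l xs @ [hd (rot l xs)]) = path_prod H (l # bs @ [k]) * path_prod H (k # cs @ [l])"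
          using path_prod_append[of H "l # bs" k "cs @ [l]"] by (simp add: rot_l as)
        moreover have "path_prod H (xs @ [hd xs]) = path_prod H (k # cs @ [l]) * path_prod H (l # bs @ [k])"
          using path_prod_append[of H "k # cs" l "bs @ [k]"] by (simp add: ab as)
        ultimately show ?thesis unfolding q_def using qre_mult_commute by metis
      qed
      moreover have "rot l xs \<in> cycles_at \<beta> l" "k \<in> set (rot l xs)" "set (rot l xs) = set xs"
        using xs' unfolding rot_l cycles_at_def by (auto simp: ab as)
      moreover have "s (rot l xs) = s xs" unfolding s_def rot_l by (simp add: ab add.commute)
      ultimately show ?thesis by blast
    qed
    show ?thesis
      unfolding both_def
      by (rule sum.reindex_bij_witness[where i = "rot i" and j = "rot j"])
        (use rot ij in \<open>force+\<close>)
  qed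
  ultimately show ?thesis unfolding split[OF i j] split[OF j i] by simp
qed

text \<open>Reality and independence of the column go through one induction, as each uses facts on
  proper subsets. Reality upgrades equality of real parts to equality.\<close>

lemma cdet_eq_pdet_real:
  assumes "\<beta> \<subseteq> {..<n}"
  shows "pdet \<beta> H = of_real (qre (pdet \<beta> H)) \<and> (\<forall>i\<in>\<beta>. cdet \<beta> i H = pdet \<beta> H)"
proof -
  have "finite \<beta>" using assms finite_subset by blast
  then show ?thesis using assms
  proof (induction \<beta> rule: finite_psubset_induct)
    case (psubset \<beta>)
    show ?case
    proof (cases "\<beta> = {}")
      case True
      then show ?thesis by (simp add: pdet_def)
    next
      case False
      then have m: "Min \<beta> \<in> \<beta>" using psubset.hyps by simp
      have real: "cdet \<beta> i H = of_real (qre (cdet \<beta> i H))" if "i \<in> \<beta>" for i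
        using qcnj_cdet[OF psubset.prems that] psubset.IH psubset.prems qcnj_fixed_imp_real by blast
      have "qre (cdet \<beta> i H) = qre (cdet \<beta> (Min \<beta>) H)" if "i \<in> \<beta>" for i
      proof (cases "i = Min \<beta>")
        case False
        show ?thesis
          by (rule qre_cdet_eq[OF psubset.prems that m False]) (use psubset in blast)+
      qed simp
      then have "cdet \<beta> i H = cdet \<beta> (Min \<beta>) H" if "i \<in> \<beta>" for i
        using that real m by metis
      then show ?thesis using real[OF m] False by (simp add: pdet_def)
    qed
  qed
qed

lemma pdet_real: "\<beta> \<subseteq> {..<n} \<Longrightarrow> pdet \<beta> H = of_real (qre (pdet \<beta> H))"
  and cdet_eq_pdet: "\<beta> \<subseteq> {..<n} \<Longrightarrow> i \<in> \<beta> \<Longrightarrow> cdet \<beta> i H = pdet \<beta> H"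
  using cdet_eq_pdet_real by blast+

text \<open>Nonemptiness makes the described value unique: over the empty set every \<open>d\<close>
  would qualify.\<close>

lemma hdet_eq:
  assumes "\<beta> \<subseteq> {..<n}" "\<beta> \<noteq> {}"
  shows "hdet \<beta> H = qre (pdet \<beta> H)"
  unfolding hdet_def
proof (rule the_equality)
  show "\<forall>j\<in>\<beta>. cdet \<beta> j H = of_real (qre (pdet \<beta> H))"
    using cdet_eq_pdet[OF assms(1)] pdet_real[OF assms(1)] by simp
  fix d assume "\<forall>j\<in>\<beta>. cdet \<beta> j H = of_real d"
  then show "d = qre (pdet \<beta> H)"
    using cdet_eq_pdet[OF assms(1)] assms(2) by force
qed

text \<open>The complementary minors are real, so the first entry \<open>H $$ (i, u)\<close> can be
  pulled to the far left. The minus sign comes from the cycle being one longer than its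
  tail.\<close>

lemma path_sum_Cons:
  assumes \<beta>: "\<beta> \<subseteq> {..<n}" and i: "i \<in> \<beta>"
  shows "path_sum H \<beta> i w =
    pdet (\<beta> - {i}) H * w i - (\<Sum>u\<in>\<beta> - {i}. H $$ (i, u) * path_sum H (\<beta> - {i}) u w)"
proof -
  have fin: "finite \<beta>" using \<beta> finite_subset by blast
  have "(- 1) ^ (length (i # xs) - 1) * pdet (\<beta> - set (i # xs)) H * (path_prod H (i # xs) * w (last (i # xs))) =
      - (H $$ (i, u) * ((- 1) ^ (length xs - 1) * pdet (\<beta> - {i} - set xs) H * (path_prod H xs * w (last xs))))"
    if "xs \<in> cycles_at (\<beta> - {i}) u" for xs u
  proof -
    obtain ys where ys: "xs = u # ys"
      using \<open>xs \<in> cycles_at (\<beta> - {i}) u\<close> by (cases xs) (auto simp: cycles_at_def)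
    have eq: "\<beta> - set (i # xs) = \<beta> - {i} - set xs" by auto
    define d where "d = qre (pdet (\<beta> - {i} - set xs) H)"
    have d: "pdet (\<beta> - {i} - set xs) H = of_real d"
      unfolding d_def by (rule pdet_real) (use \<beta> in blast)
    have "(- 1) ^ (length xs - 1) * of_real d = (of_real ((- 1) ^ (length xs - 1) * d) :: quat)"
      by simp
    moreover have "(- 1) ^ (length (i # xs) - 1) * of_real d = (of_real (- ((- 1) ^ (length xs - 1) * d)) :: quat)"
      by (simp add: ys)
    moreover have "path_prod H (i # xs) = H $$ (i, u) * path_prod H xs" "last (i # xs) = last xs"
      by (simp_all add: ys)
    ultimately show ?thesis
      unfolding eq d by (simp add: mult.assoc of_real_left_commute del: of_real_mult)
  qed
  then have "(\<Sum>u\<in>\<beta> - {i}. \<Sum>xs\<in>cycles_at (\<beta> - {i}) u.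
      (- 1) ^ (length (i # xs) - 1) * pdet (\<beta> - set (i # xs)) H * (path_prod H (i # xs) * w (last (i # xs)))) =
    (\<Sum>u\<in>\<beta> - {i}. - (H $$ (i, u) * path_sum H (\<beta> - {i}) u w))"
    unfolding path_sum_def sum_distrib_left sum_negf[symmetric] by (intro sum.cong refl)
  then show ?thesis
    unfolding path_sum_def[of H \<beta>] sum_cycles_at_Cons[OF fin i] by (simp add: sum_negf)
qed

text \<open>The analogue of a determinant with two equal columns being zero. For
  \<open>i \<noteq> j\<close> expand the first step: by induction only \<open>u = j\<close>
  survives, and its term cancels the 1-cycle term.\<close>

lemma path_sum_column:
  assumes "\<beta> \<subseteq> {..<n}" "i \<in> \<beta>" "j \<in> \<beta>"
  shows "path_sum H \<beta> i (\<lambda>a. H $$ (a, j)) = (if i = j then pdet \<beta> H else 0)"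
proof -
  have "finite \<beta>" using assms(1) finite_subset by blast
  then show ?thesis using assms
  proof (induction \<beta> arbitrary: i rule: finite_psubset_induct)
    case (psubset \<beta>)
    show ?case
    proof (cases "i = j")
      case True
      then show ?thesis
        using cdet_conv_path_sum[OF psubset.hyps, of i H] cdet_eq_pdet[of \<beta> i] psubset.prems by simp
    next
      case False
      let ?\<gamma> = "\<beta> - {i}"
      have sub: "?\<gamma> \<subseteq> {..<n}" "j \<in> ?\<gamma>" using psubset.prems False by auto
      have "(\<Sum>u\<in>?\<gamma>. H $$ (i, u) * path_sum H ?\<gamma> u (\<lambda>a. H $$ (a, j))) =
          (\<Sum>u\<in>?\<gamma>. if u = j then H $$ (i, j) * pdet ?\<gamma> H else 0)"
        using psubset.prems by (intro sum.cong refl) (subst psubset.IH[OF _ sub(1) _ sub(2)], auto)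
      also have "\<dots> = H $$ (i, j) * pdet ?\<gamma> H" using psubset.hyps sub(2) by simp
      also have "\<dots> = pdet ?\<gamma> H * H $$ (i, j)" using pdet_real[OF sub(1)] of_real_commute by metis
      finally show ?thesis
        unfolding path_sum_Cons[OF psubset.prems(1,2)] using False by simp
    qed
  qed
qed

section \<open>Sums of principal minors and their adjugate recursion\<close>

definition esum :: "nat \<Rightarrow> real" where
  "esum k = (\<Sum>\<beta>\<in>J k n. qre (pdet \<beta> H))"

text \<open>\<open>esum k\<close> and \<open>adj k\<close> are \<open>d\<^sub>k\<close> and \<open>R\<^sub>k\<close>; \<open>adj n\<close> is the adjugate of \<open>H\<close>.\<close>

definition adj :: "nat \<Rightarrow> quat mat" where
  "adj k = mat n n (\<lambda>(i, j). \<Sum>\<beta>\<in>J_at k n i. path_sum H \<beta> i (\<lambda>a. if a = j then 1 else 0))"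

lemma adj_carrier [simp]: "adj k \<in> carrier_mat n n"
  by (simp add: adj_def)

lemma finite_J: "finite (J k n)" "finite (J_at k n i)"
  by (simp_all add: J_def J_at_def)

lemma adj_mult_sum:
  assumes "i < n"
  shows "(\<Sum>j<n. adj k $$ (i, j) * w j) = (\<Sum>\<beta>\<in>J_at k n i. path_sum H \<beta> i w)"
proof -
  have "(\<Sum>j<n. adj k $$ (i, j) * w j) =
      (\<Sum>\<beta>\<in>J_at k n i. \<Sum>j<n. path_sum H \<beta> i (\<lambda>a. if a = j then 1 else 0) * w j)"
    using assms by (simp add: adj_def sum_distrib_right sum.swap[of _ "J_at k n i"])
  also have "\<dots> = (\<Sum>\<beta>\<in>J_at k n i. path_sum H \<beta> i w)"
  proof (intro sum.cong refl)
    fix \<beta> assume "\<beta> \<in> J_at k n i"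
    then have \<beta>: "\<beta> \<subseteq> {..<n}" by (auto simp: J_at_def J_def)
    then have "finite \<beta>" using finite_subset by blast
    then have "path_sum H \<beta> i w = (\<Sum>j\<in>\<beta>. path_sum H \<beta> i (\<lambda>a. if a = j then 1 else 0) * w j)"
      by (rule path_sum_linear)
    also have "\<dots> = (\<Sum>j<n. path_sum H \<beta> i (\<lambda>a. if a = j then 1 else 0) * w j)"
      using \<beta> by (intro sum.mono_neutral_left) (auto simp: path_sum_unit_outside)
    finally show "(\<Sum>j<n. path_sum H \<beta> i (\<lambda>a. if a = j then 1 else 0) * w j) = path_sum H \<beta> i w" ..
  qed
  finally show ?thesis .
qed

text \<open>Turns the numerators of the Cramer formula into the entries of a matrix-vector
  product.\<close>

lemma adj_mult_vec:
  assumes "v \<in> carrier_vec n" "i < n"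
  shows "(adj k *\<^sub>v v) $ i = (\<Sum>\<beta>\<in>J_at k n i. cdet \<beta> i (replace_col H v i))"
proof -
  have "(adj k *\<^sub>v v) $ i = (\<Sum>j<n. adj k $$ (i, j) * v $ j)"
    using assms carrier_matD[OF adj_carrier[of k]]
    by (auto simp: scalar_prod_def lessThan_atLeast0 intro!: sum.cong)
  also have "\<dots> = (\<Sum>\<beta>\<in>J_at k n i. cdet \<beta> i (replace_col H v i))"
    unfolding adj_mult_sum[OF assms(2)]
    by (intro sum.cong refl cdet_replace_col[OF carrier, symmetric]) (auto simp: J_at_def J_def)
  finally show ?thesis .
qed

text \<open>A unit weight at \<open>i\<close> leaves the minor of \<open>\<beta> - {i}\<close>, and
  removing \<open>i\<close> matches the sets of size \<open>Suc k\<close> containing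
  \<open>i\<close> with the sets of size \<open>k\<close> avoiding it.\<close>

lemma adj_diag:
  assumes "i < n"
  shows "adj (Suc k) $$ (i, i) = (\<Sum>\<beta> | \<beta> \<in> J k n \<and> i \<notin> \<beta>. pdet \<beta> H)"
proof -
  have "adj (Suc k) $$ (i, i) = (\<Sum>\<beta>\<in>J_at (Suc k) n i. path_sum H \<beta> i (\<lambda>a. if a = i then 1 else 0))"
    using assms by (simp add: adj_def)
  also have "\<dots> = (\<Sum>\<beta> | \<beta> \<in> J k n \<and> i \<notin> \<beta>. pdet \<beta> H)"
    by (rule sum.reindex_bij_witness[where i = "insert i" and j = "\<lambda>\<beta>. \<beta> - {i}"])
      (use assms finite_subset[of _ "{..<n}"] in \<open>auto simp: J_at_def J_def path_sum_unit_self card_insert_if\<close>)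
  finally show ?thesis .
qed

text \<open>On the diagonal, the product supplies the minors whose index set contains
  \<open>i\<close> and \<open>adj (Suc k)\<close> those avoiding it. Off the diagonal, sets
  containing \<open>j\<close> contribute nothing to the product, and a set avoiding \<open>j\<close>
  cancels against the same set with \<open>j\<close> inserted.\<close>

lemma adj_recursion: "adj k * H + adj (Suc k) = of_real (esum k) \<cdot>\<^sub>m 1\<^sub>m n"
proof (rule eq_matI)
  fix i j assume "i < dim_row (of_real (esum k) \<cdot>\<^sub>m 1\<^sub>m n :: quat mat)" "j < dim_col (of_real (esum k) \<cdot>\<^sub>m 1\<^sub>m n :: quat mat)"
  then have ij: "i < n" "j < n" by auto
  let ?col = "\<lambda>\<beta>. path_sum H \<beta> i (\<lambda>a. H $$ (a, j))"
  have "(adj k * H) $$ (i, j) = (\<Sum>l<n. adj k $$ (i, l) * H $$ (l, j))"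
    using ij carrier carrier_matD[OF adj_carrier[of k]]
    by (auto simp: scalar_prod_def lessThan_atLeast0 intro!: sum.cong)
  then have prod: "(adj k * H) $$ (i, j) = (\<Sum>\<beta>\<in>J_at k n i. ?col \<beta>)"
    unfolding adj_mult_sum[OF ij(1)] .
  have fin: "finite \<beta>" if "\<beta> \<in> J_at k n i" for \<beta>
    using that finite_subset[of \<beta> "{..<n}"] by (auto simp: J_at_def J_def)
  have "(adj k * H) $$ (i, j) + adj (Suc k) $$ (i, j) = (if i = j then of_real (esum k) else 0)"
  proof (cases "i = j")
    case True
    have "(\<Sum>\<beta>\<in>J_at k n i. ?col \<beta>) = (\<Sum>\<beta>\<in>J_at k n i. pdet \<beta> H)"
      by (intro sum.cong refl) (auto simp: path_sum_column True J_at_def J_def)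
    moreover have "(\<Sum>\<beta>\<in>J_at k n i. pdet \<beta> H) + (\<Sum>\<beta> | \<beta> \<in> J k n \<and> i \<notin> \<beta>. pdet \<beta> H) = (\<Sum>\<beta>\<in>J k n. pdet \<beta> H)"
      by (subst sum.union_disjoint[symmetric]) (use finite_J in \<open>auto simp: J_at_def intro: sum.cong\<close>)
    moreover have "(\<Sum>\<beta>\<in>J k n. pdet \<beta> H) = of_real (esum k)"
      unfolding esum_def of_real_sum by (intro sum.cong refl pdet_real) (auto simp: J_def)
    ultimately show ?thesis
      using adj_diag[OF ij(1), of k] prod True by simp
  next
    case False
    have "(\<Sum>\<beta>\<in>J_at k n i. ?col \<beta>) = (\<Sum>\<beta> | \<beta> \<in> J_at k n i \<and> j \<notin> \<beta>. ?col \<beta>)"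
      using finite_J False
      by (intro sum.mono_neutral_right) (auto simp: path_sum_column J_at_def J_def)
    also have "\<dots> = (\<Sum>\<beta> | \<beta> \<in> J_at k n i \<and> j \<notin> \<beta>. - path_sum H (insert j \<beta>) i (\<lambda>a. if a = j then 1 else 0))"
      by (intro sum.cong refl, subst path_sum_unit_insert) (use fin in \<open>auto simp: J_at_def\<close>)
    also have "\<dots> = (\<Sum>\<beta> | \<beta> \<in> J_at (Suc k) n i \<and> j \<in> \<beta>. - path_sum H \<beta> i (\<lambda>a. if a = j then 1 else 0))"
    proof (rule sum.reindex_bij_witness[where i = "\<lambda>\<beta>. \<beta> - {j}" and j = "insert j"])
      fix \<beta> assume "\<beta> \<in> {\<beta> \<in> J_at k n i. j \<notin> \<beta>}"
      then have \<beta>: "\<beta> \<subseteq> {..<n}" "card \<beta> = k" "i \<in> \<beta>" "j \<notin> \<beta>"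
        unfolding J_at_def J_def by blast+
      then have "finite \<beta>" using finite_subset by blast
      show "insert j \<beta> - {j} = \<beta>" using \<beta>(4) by blast
      show "insert j \<beta> \<in> {\<beta> \<in> J_at (Suc k) n i. j \<in> \<beta>}"
        using \<beta> ij \<open>finite \<beta>\<close> by (simp add: J_at_def J_def)
    next
      fix \<beta> assume "\<beta> \<in> {\<beta> \<in> J_at (Suc k) n i. j \<in> \<beta>}"
      then have \<beta>: "\<beta> \<subseteq> {..<n}" "card \<beta> = Suc k" "i \<in> \<beta>" "j \<in> \<beta>"
        unfolding J_at_def J_def by blast+
      then have "card (\<beta> - {j}) = k" by simp
      then show "\<beta> - {j} \<in> {\<beta> \<in> J_at k n i. j \<notin> \<beta>}"
        using \<beta> False by (auto simp: J_at_def J_def)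
      show "insert j (\<beta> - {j}) = \<beta>" using \<beta> by blast
    qed simp
    also have "\<dots> = (\<Sum>\<beta>\<in>J_at (Suc k) n i. - path_sum H \<beta> i (\<lambda>a. if a = j then 1 else 0))"
      by (intro sum.mono_neutral_left) (use finite_J in \<open>auto simp: path_sum_unit_outside\<close>)
    also have "\<dots> = - adj (Suc k) $$ (i, j)" using ij by (simp add: adj_def sum_negf)
    finally show ?thesis using prod False by simp
  qed
  then show "(adj k * H + adj (Suc k)) $$ (i, j) = (of_real (esum k) \<cdot>\<^sub>m 1\<^sub>m n) $$ (i, j)"
    using ij carrier carrier_matD[OF adj_carrier] by simp
qed (use carrier carrier_matD[OF adj_carrier] in auto)

lemma adj_0: "adj 0 = 0\<^sub>m n n"
proof -
  have "J_at 0 n i = {}" for i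
    using finite_subset[of _ "{..<n}"] by (auto simp: J_at_def J_def)
  then show ?thesis by (auto simp: adj_def)
qed

lemma adj_Suc_n: "adj (Suc n) = 0\<^sub>m n n"
proof -
  have "J_at (Suc n) n i = {}" for i
    by (auto simp: J_at_def J_def dest!: card_mono[OF finite_lessThan])
  then show ?thesis by (auto simp: adj_def)
qed

lemma esum_0: "esum 0 = 1"
proof -
  have "J 0 n = {{}}"
    using finite_subset[of _ "{..<n}"] by (auto simp: J_def)
  then show ?thesis by (simp add: esum_def pdet_def)
qed

text \<open>Double counting: a set of size \<open>k\<close> is avoided by \<open>n - k\<close>
  indices.\<close>

lemma qre_trace_adj: "(\<Sum>i<n. qre (adj (Suc k) $$ (i, i))) = real (n - k) * esum k"
proof -
  have "(\<Sum>i<n. qre (adj (Suc k) $$ (i, i))) = (\<Sum>i<n. \<Sum>\<beta> | \<beta> \<in> J k n \<and> i \<notin> \<beta>. qre (pdet \<beta> H))"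
    by (simp add: adj_diag qre_sum)
  also have "\<dots> = (\<Sum>\<beta>\<in>J k n. \<Sum>i | i < n \<and> i \<notin> \<beta>. qre (pdet \<beta> H))"
    using sum.swap_restrict[OF finite_lessThan[of n] finite_J(1)[of k], of "\<lambda>i \<beta>. qre (pdet \<beta> H)" "\<lambda>i \<beta>. i \<notin> \<beta>"]
    by simp
  also have "\<dots> = (\<Sum>\<beta>\<in>J k n. real (n - k) * qre (pdet \<beta> H))"
  proof (intro sum.cong refl)
    fix \<beta> assume "\<beta> \<in> J k n"
    then have \<beta>: "\<beta> \<subseteq> {..<n}" "card \<beta> = k" by (auto simp: J_def)
    have "{i. i < n \<and> i \<notin> \<beta>} = {..<n} - \<beta>" by auto
    then have "card {i. i < n \<and> i \<notin> \<beta>} = n - k"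
      using \<beta> by (simp add: card_Diff_subset finite_subset)
    then show "(\<Sum>i | i < n \<and> i \<notin> \<beta>. qre (pdet \<beta> H)) = real (n - k) * qre (pdet \<beta> H)" by simp
  qed
  finally show ?thesis by (simp add: esum_def sum_distrib_left)
qed

end

section \<open>Positive definite matrices, rank and trace\<close>

lemma mult_mat_assoc:
  fixes A B C :: "'a::semiring_0 mat"
  assumes "dim_col A = dim_row B" "dim_col B = dim_row C"
  shows "A * B * C = A * (B * C)"
  by (rule assoc_mult_mat[of A "dim_row A" "dim_row B" B "dim_row C" C "dim_col C"]) (use assms in auto)

lemma mult_mat_left_commute:
  fixes X Y Z :: "'a::semiring_0 mat"
  assumes "X * Y = Y * X" "X \<in> carrier_mat n n" "Y \<in> carrier_mat n n" "dim_row Z = n"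
  shows "X * (Y * Z) = Y * (X * Z)"
  using assms by (metis carrier_matD mult_mat_assoc)

lemma minus_eq_0_imp_eq_mat:
  fixes Z Z' :: "'a::ab_group_add mat"
  assumes Z: "Z \<in> carrier_mat n k" "Z' \<in> carrier_mat n k"
    and D: "\<And>i j. i < n \<Longrightarrow> j < k \<Longrightarrow> (Z - Z') $$ (i, j) = 0"
  shows "Z = Z'"
proof (rule eq_matI)
  fix i j assume "i < dim_row Z'" "j < dim_col Z'"
  then show "Z $$ (i, j) = Z' $$ (i, j)" using D[of i j] Z by simp
qed (use Z in auto)

lemma smult_of_real_mult_left:
  assumes "dim_col A = dim_row B"
  shows "(of_real r \<cdot>\<^sub>m A) * B = (of_real r :: quat) \<cdot>\<^sub>m (A * B)"
  using assms by (intro eq_matI) (auto simp: scalar_prod_def sum_distrib_left mult.assoc)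

lemma smult_of_real_mult_right:
  assumes "dim_col A = dim_row B"
  shows "A * (of_real r \<cdot>\<^sub>m B) = (of_real r :: quat) \<cdot>\<^sub>m (A * B)"
  using assms by (intro eq_matI) (auto simp: scalar_prod_def sum_distrib_left of_real_left_commute)

lemma smult_of_real_mult_vec:
  assumes "dim_col A = dim_vec v"
  shows "(of_real r \<cdot>\<^sub>m A) *\<^sub>v v = (of_real r :: quat) \<cdot>\<^sub>v (A *\<^sub>v v)"
  using assms by (intro eq_vecI) (auto simp: scalar_prod_def sum_distrib_left mult.assoc)

lemma dim_conj_transpose [simp]:
  "dim_row (conj_transpose A) = dim_col A" "dim_col (conj_transpose A) = dim_row A"
  by (simp_all add: conj_transpose_def)

lemma conj_transpose_carrier [simp]: "A \<in> carrier_mat m n \<Longrightarrow> conj_transpose A \<in> carrier_mat n m"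
  by auto

lemma conj_transpose_index [simp]:
  "i < dim_col A \<Longrightarrow> j < dim_row A \<Longrightarrow> conj_transpose A $$ (i, j) = qcnj (A $$ (j, i))"
  by (simp add: conj_transpose_def)

lemma conj_transpose_conj_transpose [simp]: "conj_transpose (conj_transpose A) = A"
  by (intro eq_matI) auto

lemma conj_transpose_mult:
  assumes "dim_col A = dim_row B"
  shows "conj_transpose (A * B) = conj_transpose B * conj_transpose A"
  using assms by (intro eq_matI) (auto simp: scalar_prod_def qcnj_sum qcnj_mult)

lemma conj_transpose_smult_of_real:
  "conj_transpose (of_real r \<cdot>\<^sub>m A) = of_real r \<cdot>\<^sub>m conj_transpose A"
  by (intro eq_matI) (auto simp: qcnj_mult of_real_commute)

lemma hermitianD: "hermitian P \<Longrightarrow> conj_transpose P = P" "hermitian P \<Longrightarrow> dim_col P = dim_row P"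
  by (auto simp: hermitian_def)

text \<open>The diagonal entries of the product are values of the form of \<open>P\<close> at the
  columns of \<open>conj_transpose W\<close>, so each of these columns vanishes.\<close>

lemma positive_definite_mult_eq_0:
  assumes P: "positive_definite P" "P \<in> carrier_mat n n" and W: "W \<in> carrier_mat k n"
    and eq: "W * P * conj_transpose W = 0\<^sub>m k k"
  shows "W = 0\<^sub>m k n"
proof (rule eq_matI)
  fix i j assume "i < dim_row (0\<^sub>m k n :: quat mat)" "j < dim_col (0\<^sub>m k n :: quat mat)"
  then have ij: "i < k" "j < n" by auto
  define x where "x = col (conj_transpose W) i"
  have x: "x \<in> carrier_vec n" using W by (intro carrier_vecI) (auto simp: x_def)
  have row: "map_vec qcnj x = row W i"
    using W ij by (intro eq_vecI) (auto simp: x_def)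
  have "W * (P * conj_transpose W) = 0\<^sub>m k k"
    using eq P(2) W by (subst mult_mat_assoc[symmetric]) auto
  then have "(W * (P * conj_transpose W)) $$ (i, i) = 0" using ij by simp
  moreover have "col (P * conj_transpose W) i = P *\<^sub>v x"
    unfolding x_def using W ij by (intro col_mult2[OF P(2), of _ k]) auto
  then have "(W * (P * conj_transpose W)) $$ (i, i) = row W i \<bullet> (P *\<^sub>v x)"
    using P(2) W ij by simp
  ultimately have "map_vec qcnj x \<bullet> (P *\<^sub>v x) = of_real 0" by (simp add: row)
  then have "x = 0\<^sub>v n"
    using P x unfolding positive_definite_def by (metis carrier_matD(1) of_real_eq_iff less_irrefl)
  then have "row W i $ j = 0" using ij row by (metis index_map_vec(1) index_zero_vec qcnj_0)
  then show "W $$ (i, j) = 0\<^sub>m k n $$ (i, j)" using W ij by simp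
qed (use W in auto)

lemma mult_conj_transpose_eq_0:
  assumes W: "W \<in> carrier_mat k n" and eq: "W * conj_transpose W = 0\<^sub>m k k"
  shows "W = 0\<^sub>m k n"
proof (rule eq_matI)
  fix i j assume "i < dim_row (0\<^sub>m k n :: quat mat)" "j < dim_col (0\<^sub>m k n :: quat mat)"
  then have ij: "i < k" "j < n" by auto
  have "(\<Sum>l<n. qnorm2 (W $$ (i, l))) = qre ((W * conj_transpose W) $$ (i, i))"
    using W ij by (simp add: scalar_prod_def mult_qcnj_self qre_sum lessThan_atLeast0)
  also have "\<dots> = 0" using ij by (simp add: eq)
  finally have "qnorm2 (W $$ (i, j)) = 0"
    using ij by (subst (asm) sum_nonneg_eq_0_iff) (auto simp: qnorm2_def)
  then show "W $$ (i, j) = 0\<^sub>m k n $$ (i, j)" using ij by (simp add: qnorm2_eq_0_iff)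
qed (use W in auto)

text \<open>If \<open>P * D = 0\<close> then also the form of \<open>P\<close> vanishes on the
  columns of \<open>D\<close>, where \<open>D\<close> is the difference.\<close>

lemma positive_definite_cancel:
  assumes P: "positive_definite P" "P \<in> carrier_mat n n"
    and Z: "Z \<in> carrier_mat n k" "Z' \<in> carrier_mat n k" and eq: "P * Z = P * Z'"
  shows "Z = Z'"
proof -
  let ?D = "Z - Z'"
  have "P * ?D = 0\<^sub>m n k"
    using mult_minus_distrib_mat[OF P(2) Z] eq P(2) Z by simp
  then have eq0: "conj_transpose ?D * P * conj_transpose (conj_transpose ?D) = 0\<^sub>m k k"
    using P(2) Z by (subst mult_mat_assoc) auto
  have "conj_transpose ?D \<in> carrier_mat k n" using Z by auto
  from positive_definite_mult_eq_0[OF P this eq0] have "?D = conj_transpose (0\<^sub>m k n)"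
    by (metis conj_transpose_conj_transpose)
  then have D: "?D $$ (i, j) = 0" if "i < n" "j < k" for i j
    using that by simp
  show ?thesis by (rule minus_eq_0_imp_eq_mat[OF Z D])
qed

text \<open>\<open>A\<close> factors through a maximal independent set \<open>S\<close> of its columns by a coefficient matrix \<open>t\<close>, and \<open>t\<close> times the
  columns \<open>S\<close> of \<open>F\<close> is the identity of order \<open>card S\<close>.\<close>

lemma trace_eq_qrank:
  assumes A: "A \<in> carrier_mat m n" and F: "F \<in> carrier_mat n n" and Y: "Y \<in> carrier_mat n m"
    and AF: "A * F = A" and YA: "F = Y * A"
  shows "(\<Sum>i<n. qre (F $$ (i, i))) = real (qrank A)"
proof -
  let ?R = "{card S | S. S \<subseteq> {..<dim_col A} \<and> right_independent_cols A S}"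
  have "right_independent_cols A {}" by (simp add: right_independent_cols_def)
  then have ne: "?R \<noteq> {}" by blast
  have "?R \<subseteq> {..dim_col A}" using card_mono[of "{..<dim_col A}"] by fastforce
  then have fin: "finite ?R" using finite_subset by blast
  have "qrank A \<in> ?R" unfolding qrank_def by (rule Max_in[OF fin ne])
  then obtain S where S: "S \<subseteq> {..<n}" "right_independent_cols A S" "card S = qrank A"
    using A by auto
  have finS: "finite S" using S(1) finite_subset by blast
  have span: "\<exists>t. \<forall>i<m. A $$ (i, j) = (\<Sum>l\<in>S. A $$ (i, l) * t l)" if j: "j < n" for j
  proof (cases "j \<in> S")
    case True
    then show ?thesis using finS
      by (intro exI[of _ "\<lambda>l. if l = j then 1 else 0"]) (simp add: if_distrib cong: if_cong)
  next
    case False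
    \<comment> \<open>Otherwise a larger independent set would contradict the maximality of
      \<open>card S\<close>.\<close>
    have "\<not> right_independent_cols A (insert j S)"
    proof
      assume "right_independent_cols A (insert j S)"
      then have "card (insert j S) \<in> ?R" using S(1) j A by auto
      then have "card (insert j S) \<le> qrank A" unfolding qrank_def by (rule Max_ge[OF fin])
      then show False using S(3) finS False by simp
    qed
    then obtain c where c: "\<And>i. i < m \<Longrightarrow> (\<Sum>l\<in>insert j S. A $$ (i, l) * c l) = 0"
      and nz: "\<exists>l\<in>insert j S. c l \<noteq> 0"
      using A unfolding right_independent_cols_def by auto
    have eq: "A $$ (i, j) * c j = - (\<Sum>l\<in>S. A $$ (i, l) * c l)" if "i < m" for i
      using c[OF that] finS False by (simp add: eq_neg_iff_add_eq_0)
    have cj: "c j \<noteq> 0"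
    proof
      assume "c j = 0"
      then have "\<forall>i<dim_row A. (\<Sum>l\<in>S. A $$ (i, l) * c l) = 0" using eq A by simp
      then have "\<forall>l\<in>S. c l = 0" using S(2) unfolding right_independent_cols_def by blast
      then show False using nz \<open>c j = 0\<close> by blast
    qed
    \<comment> \<open>Coefficients act from the right, so the division by \<open>c j\<close> has to
      be on the right as well.\<close>
    have "A $$ (i, j) = (\<Sum>l\<in>S. A $$ (i, l) * (- c l * inverse (c j)))" if "i < m" for i
    proof -
      have "A $$ (i, j) = A $$ (i, j) * c j * inverse (c j)" using cj by (simp add: mult.assoc)
      also have "\<dots> = (\<Sum>l\<in>S. A $$ (i, l) * (- c l * inverse (c j)))"
        unfolding eq[OF that] by (simp add: sum_distrib_right sum_negf mult.assoc)
      finally show ?thesis .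
    qed
    then show ?thesis by (intro exI[of _ "\<lambda>l. - c l * inverse (c j)"]) blast
  qed
  obtain t where t: "\<And>i j. j < n \<Longrightarrow> i < m \<Longrightarrow> A $$ (i, j) = (\<Sum>l\<in>S. A $$ (i, l) * t j l)"
    using span by metis
  \<comment> \<open>Left multiplication by \<open>Y\<close> carries the column relations of
    \<open>A\<close> over to \<open>F\<close>.\<close>
  have F_span: "F $$ (i, j) = (\<Sum>l\<in>S. F $$ (i, l) * t j l)" if "i < n" "j < n" for i j
  proof -
    have F_eq: "F $$ (i, l) = (\<Sum>k<m. Y $$ (i, k) * A $$ (k, l))" if "l < n" for l
      using that \<open>i < n\<close> A Y unfolding YA by (simp add: scalar_prod_def lessThan_atLeast0)
    have "F $$ (i, j) = (\<Sum>k<m. \<Sum>l\<in>S. Y $$ (i, k) * A $$ (k, l) * t j l)"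
      unfolding F_eq[OF that(2)] using t that
      by (intro sum.cong refl) (simp add: sum_distrib_left mult.assoc)
    also have "\<dots> = (\<Sum>l\<in>S. F $$ (i, l) * t j l)"
      using S(1) by (subst sum.swap) (intro sum.cong refl, auto simp: F_eq sum_distrib_right)
    finally show ?thesis .
  qed
  \<comment> \<open>By \<open>A * F = A\<close>, these sums are coefficients of column
    \<open>j\<close> of \<open>A\<close> in the columns \<open>S\<close>; independence forces them
    to be the unit coefficients.\<close>
  have dual: "(\<Sum>i<n. t i l * F $$ (i, j)) = (if l = j then 1 else 0)" if "l \<in> S" "j \<in> S" for l j
  proof -
    define c where "c l = (\<Sum>i<n. t i l * F $$ (i, j)) - (if l = j then 1 else 0)" for l
    have jn: "j < n" using that S(1) by auto
    have "(\<Sum>l\<in>S. A $$ (k, l) * c l) = 0" if k: "k < m" for k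
    proof -
      have "(\<Sum>l\<in>S. A $$ (k, l) * (\<Sum>i<n. t i l * F $$ (i, j))) = (\<Sum>i<n. A $$ (k, i) * F $$ (i, j))"
      proof -
        have "(\<Sum>i<n. A $$ (k, i) * F $$ (i, j)) = (\<Sum>i<n. (\<Sum>l\<in>S. A $$ (k, l) * t i l) * F $$ (i, j))"
          using t k by (intro sum.cong refl) (metis lessThan_iff)
        also have "\<dots> = (\<Sum>l\<in>S. A $$ (k, l) * (\<Sum>i<n. t i l * F $$ (i, j)))"
          unfolding sum_distrib_right sum_distrib_left by (subst sum.swap) (simp add: mult.assoc)
        finally show ?thesis ..
      qed
      also have "\<dots> = (A * F) $$ (k, j)"
        using A F k jn by (simp add: scalar_prod_def lessThan_atLeast0)
      finally have "(\<Sum>l\<in>S. A $$ (k, l) * (\<Sum>i<n. t i l * F $$ (i, j))) = A $$ (k, j)" by (simp only: AF)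
      moreover have "A $$ (k, l) * c l = A $$ (k, l) * (\<Sum>i<n. t i l * F $$ (i, j)) - (if l = j then A $$ (k, j) else 0)" for l
        by (simp add: c_def right_diff_distrib)
      ultimately show ?thesis
        using finS \<open>j \<in> S\<close> by (simp only: sum_subtractf sum.delta if_True) simp
    qed
    then have "\<forall>l\<in>S. c l = 0"
      using S(2) A unfolding right_independent_cols_def by auto
    then show ?thesis using that(1) by (auto simp: c_def)
  qed
  \<comment> \<open>Cyclicity of the trace: exchanging the factors under \<open>qre\<close> turns
    the trace of order \<open>n\<close> into the trace of the identity indexed by
    \<open>S\<close>.\<close>
  have "(\<Sum>i<n. qre (F $$ (i, i))) = (\<Sum>i<n. \<Sum>l\<in>S. qre (F $$ (i, l) * t i l))"
    by (intro sum.cong refl) (subst F_span, auto simp: qre_sum)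
  also have "\<dots> = (\<Sum>l\<in>S. \<Sum>i<n. qre (t i l * F $$ (i, l)))"
    by (subst sum.swap) (simp only: qre_mult_commute)
  also have "\<dots> = (\<Sum>l\<in>S. qre (\<Sum>i<n. t i l * F $$ (i, l)))"
    by (simp add: qre_sum)
  also have "\<dots> = (\<Sum>l\<in>S. 1)"
    by (intro sum.cong refl) (subst dual, auto)
  finally show ?thesis using S(3) by simp
qed

section \<open>Group inverse of a Hermitian matrix\<close>

context hermitian_matrix
begin

lemma conj_transpose_self: "conj_transpose H = H"
  using herm by (simp add: hermitian_def)

lemma adj_Suc: "adj (Suc k) = of_real (esum k) \<cdot>\<^sub>m 1\<^sub>m n - adj k * H"
proof (rule eq_matI)
  fix i j
  assume "i < dim_row (of_real (esum k) \<cdot>\<^sub>m 1\<^sub>m n - adj k * H)" "j < dim_col (of_real (esum k) \<cdot>\<^sub>m 1\<^sub>m n - adj k * H)"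
  then have ij: "i < n" "j < n" using carrier carrier_matD[OF adj_carrier] by auto
  have "(adj k * H) $$ (i, j) + adj (Suc k) $$ (i, j) = (of_real (esum k) \<cdot>\<^sub>m 1\<^sub>m n) $$ (i, j)"
    unfolding adj_recursion[symmetric] using ij carrier carrier_matD[OF adj_carrier] by simp
  then show "adj (Suc k) $$ (i, j) = (of_real (esum k) \<cdot>\<^sub>m 1\<^sub>m n - adj k * H) $$ (i, j)"
    using ij carrier carrier_matD[OF adj_carrier] by (simp add: algebra_simps)
qed (use carrier carrier_matD[OF adj_carrier] in auto)

text \<open>Induction along the recursion, in which \<open>adj (Suc k)\<close> arises from
  \<open>adj k\<close>, \<open>H\<close> and a central real scalar.\<close>

lemma adj_commute:
  assumes C: "C \<in> carrier_mat n n" and CH: "C * H = H * C"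
  shows "C * adj k = adj k * C"
proof (induction k)
  case 0
  then show ?case using C by (simp add: adj_0)
next
  case (Suc k)
  note dims = carrier_matD[OF carrier] carrier_matD[OF C] carrier_matD[OF adj_carrier[of k]]
  have AH: "adj k * H \<in> carrier_mat n n" by (rule mult_carrier_mat[OF adj_carrier carrier])
  have I: "of_real (esum k) \<cdot>\<^sub>m 1\<^sub>m n \<in> carrier_mat n n" by simp
  have "C * (adj k * H) = adj k * H * C"
    using Suc CH by (metis mult_mat_assoc dims)
  moreover have "C * (of_real (esum k) \<cdot>\<^sub>m 1\<^sub>m n) = (of_real (esum k) \<cdot>\<^sub>m 1\<^sub>m n) * C"
    using C by (simp add: smult_of_real_mult_left smult_of_real_mult_right)
  ultimately show ?case
    unfolding adj_Suc mult_minus_distrib_mat[OF C I AH] minus_mult_distrib_mat[OF I AH C] by simp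
qed

lemma conj_transpose_adj: "conj_transpose (adj k) = adj k"
proof (induction k)
  case 0
  then show ?case by (auto simp: adj_0)
next
  case (Suc k)
  note dims = carrier_matD[OF carrier] carrier_matD[OF adj_carrier[of k]]
  have "conj_transpose (adj k * H) = adj k * H"
    using Suc conj_transpose_mult[of "adj k" H] adj_commute[OF carrier refl, of k] conj_transpose_self dims by simp
  then have "qcnj ((adj k * H) $$ (j, i)) = (adj k * H) $$ (i, j)" if "i < n" "j < n" for i j
    using that dims conj_transpose_index[of i "adj k * H" j] by simp
  then show ?case unfolding adj_Suc
    using dims by (intro eq_matI) (auto simp: qcnj_diff simp del: index_mult_mat(1))
qed

text \<open>Descending induction from \<open>adj (Suc n) = 0\<close>. If \<open>esum k = 0\<close>,
  the recursion makes \<open>Z = adj k * H\<close> the negative of \<open>adj (Suc k)\<close>, so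
  \<open>Z * H = 0\<close>. Then \<open>Z * conj_transpose Z = Z * H * adj k = 0\<close>, which
  forces \<open>Z = 0\<close>.\<close>

lemma adj_mult_eq_0:
  assumes s: "\<And>k. s < k \<Longrightarrow> k \<le> n \<Longrightarrow> esum k = 0" and "s < k" "k \<le> Suc n"
  shows "adj k * H = 0\<^sub>m n n"
  using assms(3,2)
proof (induction k rule: inc_induct)
  case base
  then show ?case using carrier by (simp add: adj_Suc_n)
next
  case (step k)
  note dims = carrier_matD[OF carrier] carrier_matD[OF adj_carrier[of k]]
  let ?Z = "adj k * H"
  have Z: "?Z \<in> carrier_mat n n" by (rule mult_carrier_mat[OF adj_carrier carrier])
  have "adj (Suc k) = - ?Z"
    using s[of k] step(2,4) dims unfolding adj_Suc by (intro eq_matI) auto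
  then have neg: "- (?Z * H) = 0\<^sub>m n n" using step Z carrier by simp
  have "?Z * H = - (- (?Z * H))" by (intro eq_matI) auto
  then have ZH: "?Z * H = 0\<^sub>m n n" unfolding neg by (auto simp: mat_eq_iff)
  have "conj_transpose ?Z = H * adj k"
    using conj_transpose_mult[of "adj k" H] dims conj_transpose_self conj_transpose_adj by simp
  then have "?Z * conj_transpose ?Z = ?Z * H * adj k"
    by (metis mult_mat_assoc dims index_mult_mat(2,3))
  also have "\<dots> = 0\<^sub>m n n" unfolding ZH by (rule left_mult_zero_mat[OF adj_carrier])
  finally show ?case by (rule mult_conj_transpose_eq_0[OF Z])
qed

text \<open>Multiply the recursion at the last nonvanishing \<open>esum s\<close> by
  \<open>H\<close>: the term with \<open>adj (Suc s)\<close> drops out and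
  \<open>H * adj s * H\<close> is \<open>esum s\<close> times \<open>H\<close>.\<close>

lemma group_inverse:
  obtains s Q where "s \<le> n" "esum s \<noteq> 0" "Q = of_real (inverse (esum s)) \<cdot>\<^sub>m adj s"
    "Q \<in> carrier_mat n n" "conj_transpose Q = Q" "H * (Q * H) = H"
    "(\<Sum>i<n. qre ((Q * H) $$ (i, i))) = real s"
    "\<And>C. C \<in> carrier_mat n n \<Longrightarrow> C * H = H * C \<Longrightarrow> C * Q = Q * C"
proof -
  \<comment> \<open>The maximum exists because index \<open>0\<close> qualifies, the empty minor
    being \<open>1\<close>.\<close>
  define s where "s = Max {k. k \<le> n \<and> esum k \<noteq> 0}"
  have fin: "finite {k. k \<le> n \<and> esum k \<noteq> 0}" by simp
  moreover have "0 \<in> {k. k \<le> n \<and> esum k \<noteq> 0}" by (simp add: esum_0)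
  ultimately have "s \<in> {k. k \<le> n \<and> esum k \<noteq> 0}" unfolding s_def by (intro Max_in) blast+
  then have s: "s \<le> n" "esum s \<noteq> 0" by auto
  have max: "esum k = 0" if "s < k" "k \<le> n" for k
    using Max_ge[OF fin, of k] that unfolding s_def[symmetric] by fastforce
  let ?c = "inverse (esum s)"
  define Q where "Q = of_real ?c \<cdot>\<^sub>m adj s"
  note dims = carrier_matD[OF carrier] carrier_matD[OF adj_carrier[of s]] carrier_matD[OF adj_carrier[of "Suc s"]]
  have Q: "Q \<in> carrier_mat n n" by (simp add: Q_def)
  have QH: "Q * H = of_real ?c \<cdot>\<^sub>m (adj s * H)"
    unfolding Q_def using dims by (simp add: smult_of_real_mult_left)
  have HA: "H * adj (Suc s) = 0\<^sub>m n n"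
    unfolding adj_commute[OF carrier refl] by (rule adj_mult_eq_0[of s]) (use max s in auto)
  have AH: "adj s * H \<in> carrier_mat n n" by (rule mult_carrier_mat[OF adj_carrier carrier])
  have "H * (adj s * H + adj (Suc s)) = of_real (esum s) \<cdot>\<^sub>m H"
    unfolding adj_recursion using carrier by (simp add: smult_of_real_mult_right)
  then have HAH: "H * (adj s * H) = of_real (esum s) \<cdot>\<^sub>m H"
    unfolding mult_add_distrib_mat[OF carrier AH adj_carrier] HA using carrier AH by simp
  have "H * (Q * H) = H"
    unfolding QH using dims s(2)
    by (simp add: smult_of_real_mult_right HAH flip: of_real_mult) (intro eq_matI, auto simp flip: mult.assoc of_real_mult)
  moreover have "(\<Sum>i<n. qre ((Q * H) $$ (i, i))) = real s"
  proof -
    have "qre ((Q * H) $$ (i, i)) = 1 - ?c * qre (adj (Suc s) $$ (i, i))" if "i < n" for i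
    proof -
      have "(adj s * H) $$ (i, i) + adj (Suc s) $$ (i, i) = of_real (esum s)"
        using that dims arg_cong[OF adj_recursion[of s], of "\<lambda>M. M $$ (i, i)"] by simp
      then have "qre ((adj s * H) $$ (i, i)) = esum s - qre (adj (Suc s) $$ (i, i))"
        by (metis add_diff_cancel_right' qre_add qre_of_real)
      then show ?thesis
        unfolding QH using that dims s(2)
        by (simp add: qre_of_real_mult right_diff_distrib del: of_real_inverse index_mult_mat(1))
    qed
    then have "(\<Sum>i<n. qre ((Q * H) $$ (i, i))) = real n - ?c * (\<Sum>i<n. qre (adj (Suc s) $$ (i, i)))"
      by (simp add: sum_subtractf sum_distrib_left)
    \<comment> \<open>The real trace of \<open>adj (Suc s)\<close> is
      \<open>(n - s) * esum s\<close>, so \<open>n - (n - s) = s\<close> remains.\<close>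
    also have "\<dots> = real s" unfolding qre_trace_adj using s by (simp add: field_simps of_nat_diff)
    finally show ?thesis .
  qed
  moreover have "C * Q = Q * C" if "C \<in> carrier_mat n n" "C * H = H * C" for C
    unfolding Q_def using adj_commute[OF that, of s] dims carrier_matD[OF that(1)]
    by (simp add: smult_of_real_mult_left smult_of_real_mult_right)
  moreover have "conj_transpose Q = Q"
    unfolding Q_def conj_transpose_smult_of_real conj_transpose_adj ..
  ultimately show thesis using that s Q Q_def by blast
qed

end

text \<open>Cancelling \<open>P\<close> in \<open>P * (Q * P) = P\<close> shows that the group
  inverse \<open>Q\<close> is a left inverse; it commutes with \<open>P\<close>, hence is
  two-sided.\<close>

lemma positive_definite_mat_inv:
  assumes P: "positive_definite P" "P \<in> carrier_mat n n"
  shows "mat_inv P \<in> carrier_mat n n" "P * mat_inv P = 1\<^sub>m n" "mat_inv P * P = 1\<^sub>m n"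
    "conj_transpose (mat_inv P) = mat_inv P"
proof -
  have h: "hermitian P" using P by (simp add: positive_definite_def)
  interpret hermitian_matrix P n using P(2) h by unfold_locales
  obtain Q where Q: "Q \<in> carrier_mat n n" "conj_transpose Q = Q" "P * (Q * P) = P" "P * Q = Q * P"
    by (rule group_inverse) (use P(2) in blast)
  have QP: "Q * P = 1\<^sub>m n"
    by (rule positive_definite_cancel[OF P mult_carrier_mat[OF Q(1) P(2)]]) (use Q P in auto)
  have dims: "dim_row P = n" "dim_col P = n" "dim_row Q = n" "dim_col Q = n" using P Q by auto
  have "mat_inv P = Q"
    unfolding mat_inv_def
  proof (rule the_equality)
    show "Q \<in> carrier_mat (dim_row P) (dim_row P) \<and> inverts_mat P Q \<and> inverts_mat Q P"
      using Q QP dims by (simp add: inverts_mat_def)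
    fix B assume "B \<in> carrier_mat (dim_row P) (dim_row P) \<and> inverts_mat P B \<and> inverts_mat B P"
    then have B: "B \<in> carrier_mat n n" "P * B = 1\<^sub>m n" using dims by (auto simp: inverts_mat_def)
    have "B = Q * P * B" using B QP by simp
    also have "\<dots> = Q * (P * B)" using B dims by (intro mult_mat_assoc) auto
    also have "\<dots> = Q" using B Q by simp
    finally show "B = Q" .
  qed
  then show "mat_inv P \<in> carrier_mat n n" "P * mat_inv P = 1\<^sub>m n" "mat_inv P * P = 1\<^sub>m n"
    "conj_transpose (mat_inv P) = mat_inv P"
    using Q QP by simp_all
qed

section \<open>Weighted Moore-Penrose solution\<close>

instance quat :: real_div_algebra ..

text \<open>With \<open>D = Z - Z'\<close> the hypothesis makes the form of \<open>P\<close> vanish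
  on the columns of \<open>A * D\<close>.\<close>

lemma positive_definite_gram_cancel:
  assumes P: "positive_definite P" "P \<in> carrier_mat m m" and A: "A \<in> carrier_mat m n"
    and Z: "Z \<in> carrier_mat n k" "Z' \<in> carrier_mat n k"
    and eq: "conj_transpose A * (P * (A * Z)) = conj_transpose A * (P * (A * Z'))"
  shows "A * Z = A * Z'"
proof -
  let ?C = "conj_transpose A" and ?D = "Z - Z'"
  have D: "?D \<in> carrier_mat n k" using Z by auto
  have C: "?C \<in> carrier_mat n m" using A by simp
  have AZ: "A * Z \<in> carrier_mat m k" "A * Z' \<in> carrier_mat m k" using A Z by auto
  have AD: "A * ?D = A * Z - A * Z'" by (rule mult_minus_distrib_mat[OF A Z])
  have PAZ: "P * (A * Z) \<in> carrier_mat m k" "P * (A * Z') \<in> carrier_mat m k" using P AZ by auto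
  have "?C * (P * (A * ?D)) = 0\<^sub>m n k"
    unfolding AD mult_minus_distrib_mat[OF P(2) AZ] mult_minus_distrib_mat[OF C PAZ] eq
    using A C PAZ by (intro eq_matI) auto
  then have "conj_transpose ?D * (?C * (P * (A * ?D))) = 0\<^sub>m k k"
    using Z by simp
  then have "conj_transpose (A * ?D) * P * conj_transpose (conj_transpose (A * ?D)) = 0\<^sub>m k k"
    using P A Z by (simp add: conj_transpose_mult mult_mat_assoc)
  moreover have "conj_transpose (A * ?D) \<in> carrier_mat k m"
    by (rule conj_transpose_carrier[OF mult_carrier_mat[OF A D]])
  ultimately have "conj_transpose (A * ?D) = 0\<^sub>m k m"
    using positive_definite_mult_eq_0[OF P] by blast
  then have zero: "A * ?D = conj_transpose (0\<^sub>m k m)" by (metis conj_transpose_conj_transpose)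
  have "(A * Z - A * Z') $$ (i, j) = 0" if "i < m" "j < k" for i j
    unfolding AD[symmetric] zero using that by simp
  then show ?thesis by (rule minus_eq_0_imp_eq_mat[OF AZ])
qed

text \<open>For two solutions, \<open>A * X\<close> and \<open>A * Y\<close> are idempotents with
  the same range, both self-adjoint for the form of \<open>M\<close>, and therefore equal. Likewise
  \<open>X * A\<close> and \<open>Y * A\<close> have the same kernel and are self-adjoint for the
  form of \<open>N\<close>.\<close>

lemma weighted_mp_inverse_eqI:
  assumes A: "A \<in> carrier_mat m n"
    and M: "M \<in> carrier_mat m m" "positive_definite M"
    and N: "N \<in> carrier_mat n n" "positive_definite N"
    and X: "is_weighted_mp_inverse M N A X"
  shows "weighted_mp_inverse M N A = X"
  unfolding weighted_mp_inverse_def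
proof (rule the_equality)
  show "is_weighted_mp_inverse M N A X" by (rule X)
  fix Y assume Y: "is_weighted_mp_inverse M N A Y"
  note dims = carrier_matD[OF A] carrier_matD[OF M(1)] carrier_matD[OF N(1)]
  have herm: "conj_transpose M = M" "conj_transpose N = N"
    using M N by (auto simp: positive_definite_def hermitianD)
  have MP: "Z \<in> carrier_mat n m" "dim_row Z = n" "dim_col Z = m" "A * (Z * A) = A" "Z * (A * Z) = Z"
    "conj_transpose (A * Z) * M = M * (A * Z)" "conj_transpose (Z * A) * N = N * (Z * A)"
    if "is_weighted_mp_inverse M N A Z" for Z
  proof -
    show Z: "Z \<in> carrier_mat n m" using that A by (auto simp: is_weighted_mp_inverse_def)
    then show d: "dim_row Z = n" "dim_col Z = m" by auto
    have "A * Z * A = A" "Z * A * Z = Z" "conj_transpose (M * A * Z) = M * A * Z"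
      "conj_transpose (N * Z * A) = N * Z * A"
      using that by (simp_all add: is_weighted_mp_inverse_def)
    then show "A * (Z * A) = A" "Z * (A * Z) = Z"
      "conj_transpose (A * Z) * M = M * (A * Z)" "conj_transpose (Z * A) * N = N * (Z * A)"
      using conj_transpose_mult[of M "A * Z"] conj_transpose_mult[of N "Z * A"]
      by (simp_all add: dims d herm mult_mat_assoc)
  qed
  note X = MP[OF X] and Y = MP[OF Y]
  have "A * X = A * Y"
  proof -
    let ?P = "A * X" and ?Q = "A * Y"
    have PQ: "?P * ?Q = ?Q" "?Q * ?P = ?P"
      using X Y dims by (metis index_mult_mat(2,3) mult_mat_assoc)+
    have "M * ?Q = M * (?P * ?Q)" unfolding PQ ..
    also have "\<dots> = M * ?P * ?Q" using X Y dims by (intro mult_mat_assoc[symmetric]) auto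
    also have "\<dots> = conj_transpose ?P * M * ?Q" unfolding X ..
    also have "\<dots> = conj_transpose ?P * (M * ?Q)" using X Y dims by (intro mult_mat_assoc) auto
    also have "\<dots> = conj_transpose ?P * (conj_transpose ?Q * M)" unfolding Y ..
    also have "\<dots> = conj_transpose (?Q * ?P) * M"
      using X Y dims by (subst conj_transpose_mult, simp, intro mult_mat_assoc[symmetric]) auto
    also have "\<dots> = M * ?P" unfolding PQ X ..
    finally show ?thesis
      using positive_definite_cancel[OF M(2,1) mult_carrier_mat[OF A X(1)] mult_carrier_mat[OF A Y(1)]] by simp
  qed
  moreover have "X * A = Y * A"
  proof -
    let ?P = "X * A" and ?Q = "Y * A"
    have PQ: "?P * ?Q = ?P" "?Q * ?P = ?Q"
      using X Y dims by (metis index_mult_mat(2,3) mult_mat_assoc)+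
    have "N * ?P = N * (?P * ?Q)" unfolding PQ ..
    also have "\<dots> = N * ?P * ?Q" using X Y dims by (intro mult_mat_assoc[symmetric]) auto
    also have "\<dots> = conj_transpose ?P * N * ?Q" unfolding X ..
    also have "\<dots> = conj_transpose ?P * (N * ?Q)" using X Y dims by (intro mult_mat_assoc) auto
    also have "\<dots> = conj_transpose ?P * (conj_transpose ?Q * N)" unfolding Y ..
    also have "\<dots> = conj_transpose (?Q * ?P) * N"
      using X Y dims by (subst conj_transpose_mult, simp, intro mult_mat_assoc[symmetric]) auto
    also have "\<dots> = N * ?Q" unfolding PQ Y ..
    finally show ?thesis
      using positive_definite_cancel[OF N(2,1) mult_carrier_mat[OF X(1) A] mult_carrier_mat[OF Y(1) A]] by simp
  qed
  \<comment> \<open>\<open>Y = Y A Y = Y A X = X A X = X\<close>.\<close>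
  ultimately show "Y = X" using X Y dims by (metis mult_mat_assoc)
qed

lemma weighted_mp_inverse_sharp:
  assumes A: "A \<in> carrier_mat m n"
    and M: "M \<in> carrier_mat m m" "positive_definite M"
    and N: "N \<in> carrier_mat n n" "positive_definite N"
    and herm: "hermitian (sharp M N A * A)"
  defines "H \<equiv> sharp M N A * A"
  shows "hermitian_matrix.esum H n (qrank A) \<noteq> 0"
    and "weighted_mp_inverse M N A =
      of_real (inverse (hermitian_matrix.esum H n (qrank A))) \<cdot>\<^sub>m hermitian_matrix.adj H n (qrank A) * sharp M N A"
proof -
  define K where "K = mat_inv N"
  define C where "C = conj_transpose A"
  define S where "S = sharp M N A"
  note K = positive_definite_mat_inv[OF N(2,1), folded K_def]
  have CA: "conj_transpose C = A" by (simp add: C_def)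
  have dims: "dim_row A = m" "dim_col A = n" "dim_row M = m" "dim_col M = m" "dim_row N = n" "dim_col N = n"
    "dim_row K = n" "dim_col K = n" "dim_row C = n" "dim_col C = m"
    using A M(1) N(1) K(1) by (auto simp: C_def)
  have ctM: "conj_transpose M = M" and ctN: "conj_transpose N = N"
    using M N by (auto simp: positive_definite_def hermitianD)
  have S: "S = K * (C * M)" by (simp add: S_def sharp_def K_def C_def mult_mat_assoc dims[unfolded K_def C_def])
  have dimS: "dim_row S = n" "dim_col S = m" by (simp_all add: S dims)
  have H: "H = S * A" by (simp add: H_def S_def)
  have Hc: "H \<in> carrier_mat n n" by (simp add: H carrier_matI dims dimS)
  define G where "G = C * (M * A)"
  have dimG: "dim_row G = n" "dim_col G = n" by (simp_all add: G_def dims)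
  have HKG: "H = K * G" by (simp add: H S G_def mult_mat_assoc dims)
  have ctG: "conj_transpose G = G"
    by (simp add: G_def conj_transpose_mult dims ctM CA mult_mat_assoc C_def[symmetric])
  interpret hermitian_matrix H n
    using Hc herm unfolding H_def by unfold_locales
  have dimH: "dim_row H = n" "dim_col H = n" using Hc by auto
  \<comment> \<open>Here the Hermitian hypothesis on \<open>H\<close> acts: conjugate transposition
    of \<open>H = K * G\<close> swaps the factors. Hence \<open>K\<close> and \<open>N\<close>
    commute with \<open>H\<close>, and so with \<open>Q\<close>.\<close>
  have HGK: "H = G * K"
    using conj_transpose_self conj_transpose_mult[of K G] by (simp add: HKG dims dimG ctG K(4))
  have NH: "N * H = G"
    using mult_mat_assoc[of N K G] by (simp add: HKG dims dimG K(2))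
  have HN: "H * N = G"
    using mult_mat_assoc[of G K N] by (simp add: HGK dims dimG K(3))
  have KH: "K * H = H * K"
    using mult_mat_assoc[of K G K] HGK HKG by (simp add: dims dimG)
  obtain s Q where s: "s \<le> n" "esum s \<noteq> 0" and Q_def: "Q = of_real (inverse (esum s)) \<cdot>\<^sub>m adj s"
    and Q: "Q \<in> carrier_mat n n" "conj_transpose Q = Q" "H * (Q * H) = H"
    and trace: "(\<Sum>i<n. qre ((Q * H) $$ (i, i))) = real s"
    and Qcomm: "\<And>C. C \<in> carrier_mat n n \<Longrightarrow> C * H = H * C \<Longrightarrow> C * Q = Q * C"
    by (rule group_inverse) blast
  have dimQ: "dim_row Q = n" "dim_col Q = n" using Q(1) by auto
  have HQ: "H * Q = Q * H" by (rule Qcomm[OF Hc refl])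
  have KQ: "K * Q = Q * K" by (rule Qcomm[OF K(1) KH])
  have NQ: "N * Q = Q * N" by (rule Qcomm[OF N(1)]) (simp add: NH HN)
  \<comment> \<open>From \<open>H * (Q * H) = H\<close> follows \<open>G * (Q * H) = G\<close>;
    since \<open>G\<close> is the Gram matrix of \<open>A\<close> for \<open>M\<close>, its left
    factors can be cancelled.\<close>
  have AQH: "A * (Q * H) = A"
  proof -
    have "G * (Q * H) = G"
      unfolding NH[symmetric] using Q(3) by (simp add: mult_mat_assoc dims dimH dimQ)
    then have "C * (M * (A * (Q * H))) = C * (M * (A * 1\<^sub>m n))"
      using A by (simp add: G_def mult_mat_assoc dims dimH dimQ)
    then have "A * (Q * H) = A * 1\<^sub>m n"
      unfolding C_def
      by (rule positive_definite_gram_cancel[OF M(2,1) A mult_carrier_mat[OF Q(1) Hc] one_carrier_mat])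
    then show ?thesis using A by simp
  qed
  have HQC: "H * (Q * C) = C"
  proof -
    have "conj_transpose (A * (Q * H)) = H * (Q * C)"
      by (simp add: conj_transpose_mult dims dimH dimQ conj_transpose_self Q(2) C_def mult_mat_assoc)
    then show ?thesis by (simp add: AQH C_def)
  qed
  have HQS: "H * (Q * S) = S"
  proof -
    have "Q * S = K * (Q * (C * M))"
      unfolding S by (rule mult_mat_left_commute[OF KQ[symmetric] Q(1) K(1)]) (simp add: dims)
    then have "H * (Q * S) = K * (H * (Q * (C * M)))"
      using mult_mat_left_commute[OF KH[symmetric] Hc K(1), of "Q * (C * M)"] by (simp add: dimQ)
    also have "H * (Q * (C * M)) = H * (Q * C) * M"
      by (simp add: mult_mat_assoc dims dimH dimQ)
    finally show ?thesis by (simp add: HQC S)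
  qed
  \<comment> \<open>Computing the same trace a second time identifies \<open>s\<close> with the
    rank.\<close>
  have "(\<Sum>i<n. qre ((Q * H) $$ (i, i))) = real (qrank A)"
  proof (rule trace_eq_qrank[OF A _ _ AQH])
    show "Q * H \<in> carrier_mat n n" using Q(1) Hc by simp
    show "Q * S \<in> carrier_mat n m" by (simp add: carrier_matI dimQ dimS)
    show "Q * H = Q * S * A" by (simp add: H mult_mat_assoc dims dimS dimQ)
  qed
  then have sr: "s = qrank A" using trace by simp
  show "esum (qrank A) \<noteq> 0" using s(2) sr by simp
  have "is_weighted_mp_inverse M N A (Q * S)"
    unfolding is_weighted_mp_inverse_def
  proof (intro conjI)
    show "Q * S \<in> carrier_mat (dim_col A) (dim_row A)" by (simp add: carrier_matI dims dimQ dimS)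
    show "A * (Q * S) * A = A"
      using AQH by (simp add: H mult_mat_assoc dims dimQ dimS)
    have "Q * S * A * (Q * S) = Q * (H * (Q * S))"
      by (simp add: H mult_mat_assoc dims dimQ dimS)
    then show "Q * S * A * (Q * S) = Q * S" by (simp add: HQS)
    have QKC: "Q * (K * (C * M)) = K * (Q * (C * M))"
      by (rule mult_mat_left_commute[OF KQ[symmetric] Q(1) K(1)]) (simp add: dims)
    \<comment> \<open>Transposition merely interchanges \<open>Q\<close> and \<open>K\<close>, which
      commute.\<close>
    have "conj_transpose (M * A * (Q * S)) = M * (A * (K * (Q * (C * M))))"
      by (simp add: S conj_transpose_mult dims dimQ Q(2) K(4) ctM CA mult_mat_assoc C_def[symmetric])
    also have "\<dots> = M * A * (Q * S)"
      unfolding QKC[symmetric] by (simp add: S mult_mat_assoc dims dimQ)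
    finally show "conj_transpose (M * A * (Q * S)) = M * A * (Q * S)" .
    have NQH: "N * (Q * S) * A = N * (Q * H)" by (simp add: H mult_mat_assoc dims dimQ dimS)
    have "conj_transpose (N * (Q * H)) = H * (Q * N)"
      by (simp add: conj_transpose_mult dims dimQ dimH conj_transpose_self Q(2) ctN mult_mat_assoc)
    also have "\<dots> = Q * (H * N)"
      by (rule mult_mat_left_commute[OF HQ Hc Q(1)]) (simp add: dims)
    also have "\<dots> = Q * (N * H)" by (simp add: NH HN)
    also have "\<dots> = N * (Q * H)"
      by (rule mult_mat_left_commute[OF NQ[symmetric] Q(1) N(1)]) (simp add: dimH)
    finally show "conj_transpose (N * (Q * S) * A) = N * (Q * S) * A" unfolding NQH .
  qed
  from weighted_mp_inverse_eqI[OF A M N this]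
  show "weighted_mp_inverse M N A = of_real (inverse (esum (qrank A))) \<cdot>\<^sub>m adj (qrank A) * sharp M N A"
    unfolding Q_def sr S_def .
qed

lemma weighted_mp_solution_cramer:
  assumes A: "A \<in> carrier_mat m n"
    and M: "M \<in> carrier_mat m m" "positive_definite M"
    and N: "N \<in> carrier_mat n n" "positive_definite N"
    and herm: "hermitian (sharp M N A * A)"
    and b: "b \<in> carrier_vec m"
    and r: "qrank A = r" "1 \<le> r"
  shows "(\<Sum>\<beta>\<in>J r n. hdet \<beta> (sharp M N A * A)) \<noteq> 0"
    and "i < n \<Longrightarrow> (weighted_mp_inverse M N A *\<^sub>v b) $ i =
      (\<Sum>\<beta>\<in>J_at r n i. cdet \<beta> i (replace_col (sharp M N A * A) (sharp M N A *\<^sub>v b) i)) /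
      of_real (\<Sum>\<beta>\<in>J r n. hdet \<beta> (sharp M N A * A))"
proof -
  let ?S = "sharp M N A"
  have K: "mat_inv N \<in> carrier_mat n n" by (rule positive_definite_mat_inv(1)[OF N(2,1)])
  have S: "?S \<in> carrier_mat n m"
    using A M(1) K by (auto simp: sharp_def intro!: carrier_matI)
  interpret hermitian_matrix "?S * A" n
    by unfold_locales (use mult_carrier_mat[OF S A] herm in auto)
  \<comment> \<open>The bound \<open>1 \<le> r\<close> keeps every index set nonempty, where
    \<open>hdet\<close> is well determined.\<close>
  have "(\<Sum>\<beta>\<in>J r n. hdet \<beta> (?S * A)) = esum r"
    unfolding esum_def by (intro sum.cong refl hdet_eq) (use r(2) in \<open>auto simp: J_def\<close>)
  moreover note inv = weighted_mp_inverse_sharp[OF A M N herm, unfolded r(1)]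
  ultimately show "(\<Sum>\<beta>\<in>J r n. hdet \<beta> (?S * A)) \<noteq> 0" by simp
  assume i: "i < n"
  have f: "?S *\<^sub>v b \<in> carrier_vec n" using S b by simp
  have adim: "dim_row (adj r) = n" "dim_col (adj r) = n" using carrier_matD[OF adj_carrier[of r]] by auto
  have Q: "of_real (inverse (esum r)) \<cdot>\<^sub>m adj r \<in> carrier_mat n n" by simp
  have "weighted_mp_inverse M N A *\<^sub>v b = of_real (inverse (esum r)) \<cdot>\<^sub>m adj r *\<^sub>v (?S *\<^sub>v b)"
    unfolding inv(2) by (rule assoc_mult_mat_vec[OF Q S b])
  also have "\<dots> = of_real (inverse (esum r)) \<cdot>\<^sub>v (adj r *\<^sub>v (?S *\<^sub>v b))"
    by (rule smult_of_real_mult_vec) (use S adim in simp)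
  finally have "(weighted_mp_inverse M N A *\<^sub>v b) $ i =
      of_real (inverse (esum r)) * (adj r *\<^sub>v (?S *\<^sub>v b)) $ i"
    using i adim by simp
  \<comment> \<open>Division in a skew field is right multiplication by the inverse; the real scalar
    may be moved there.\<close>
  also have "\<dots> = (adj r *\<^sub>v (?S *\<^sub>v b)) $ i / of_real (esum r)"
    by (subst of_real_commute) (simp add: divide_inverse)
  finally show "(weighted_mp_inverse M N A *\<^sub>v b) $ i =
      (\<Sum>\<beta>\<in>J_at r n i. cdet \<beta> i (replace_col (?S * A) (?S *\<^sub>v b) i)) /
      of_real (\<Sum>\<beta>\<in>J r n. hdet \<beta> (?S * A))"
    unfolding adj_mult_vec[OF f i] \<open>(\<Sum>\<beta>\<in>J r n. hdet \<beta> (?S * A)) = esum r\<close> .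
qed

lemma J_full: "J n n = {{..<n}}"
proof -
  have "\<beta> = {..<n}" if "\<beta> \<subseteq> {..<n}" "card \<beta> = n" for \<beta>
    using card_subset_eq[OF finite_lessThan that(1)] that(2) by simp
  then show ?thesis by (auto simp: J_def)
qed

theorem theorem5p2:
  fixes A M N :: "quat mat" and b x f :: "quat vec" and m n :: nat
  assumes A: "A \<in> carrier_mat m n"
    and M: "M \<in> carrier_mat m m" "positive_definite M"
    and N: "N \<in> carrier_mat n n" "positive_definite N"
    and herm: "hermitian (sharp M N A * A)"
    and b: "b \<in> carrier_vec m"
    and x: "x = weighted_mp_inverse M N A *\<^sub>v b"
    and f: "f = sharp M N A *\<^sub>v b"
  shows
    "(\<forall>r. 1 \<le> r \<and> qrank A = r \<and> r \<le> m \<and> m < n \<longrightarrow>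
        (\<Sum>\<beta>\<in>J r n. hdet \<beta> (sharp M N A * A)) \<noteq> 0 \<and>
        (\<forall>i<n. x $ i =
           (\<Sum>\<beta>\<in>J_at r n i. cdet \<beta> i (replace_col (sharp M N A * A) f i)) /
           of_real (\<Sum>\<beta>\<in>J r n. hdet \<beta> (sharp M N A * A)))) \<and>
     (1 \<le> n \<and> qrank A = n \<longrightarrow>
        hdet {..<n} (sharp M N A * A) \<noteq> 0 \<and>
        (\<forall>i<n. x $ i =
           cdet {..<n} i (replace_col (sharp M N A * A) f i) /
           of_real (hdet {..<n} (sharp M N A * A))))"
proof -
  note cramer = weighted_mp_solution_cramer[OF A M N herm b]
  \<comment> \<open>At full column rank the only index set is \<open>{..<n}\<close>, so both sums
    reduce to one term and the second part is the same formula at \<open>r = n\<close>.\<close>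
  have "J_at n n i = {{..<n}}" if "i < n" for i
    using that by (auto simp: J_at_def J_full)
  then show ?thesis
    unfolding x f using cramer[of n] cramer by (auto simp: J_full)
qed

end
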